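(* With \[ \vartheta_4(a_0,a_1,a_2,a_3):=\frac{1}{4J_4}\Big[a_0\overline{J}_{4,8}\overline{J}_{6,16}+a_1q^2\overline{J}_{0,8}\overline{J}_{14,16}+a_2q\overline{J}_{4,8}\overline{J}_{14,16}+a_3q\overline{J}_{0,8}\overline{J}_{6,16}\Big], \] we have \begin{align*} D_C(0,4)&=\vartheta_4(3,-1,1,-3),\\ D_C(1,4)=D_C(3,4)&=\vartheta_4(-1,-1,1,1),\\ D_C(2,4)&=\vartheta_4(-1,3,-3,1). \end{align*}
   Context: Throughout, $q$ is a complex number with $0<|q|<1$. Write $(x)_\infty=(x;q)_\infty=\prod_{i\ge0}(1-q^ix)$. Let $j(x;q)=(x)_\infty(q/x)_\infty(q)_\infty=\sum_{n\in\mathbb Z}(-1)^nq^{\binom n2}x^n$. For integers $a$ and $m\ge1$: $J_{a,m}=j(q^a;q^m)$, $\overline{J}_{a,m}=j(-q^a;q^m)$, and $J_m=J_{m,3m}=\prod_{i\ge1}(1-q^{mi})$. Cranks: define integers $C(m,n)$ ($m\in\mathbb Z$, $n\ge0$) by $\sum_{n\ge0}\sum_{m\in\mathbb Z}C(m,n)z^mq^n=\prod_{n\ge1}\frac{1-q^n}{(1-zq^n)(1-z^{-1}q^n)}$. For $n\ge2$, $C(m,n)$ is the number of partitions $\pi$ of $n$ with crank $m$, where the crank of $\pi$ is its largest part if $\pi$ has no parts equal to $1$, and otherwise $\mu(\pi)-\nu(\pi)$ with $\nu(\pi)$ the number of ones and $\mu(\pi)$ the number of parts larger than $\nu(\pi)$;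 for $n\le1$ the generating function gives $C(0,0)=1$, $C(1,1)=C(-1,1)=1$, $C(0,1)=-1$, all other values $0$. For $M\ge1$ and integer $a$, $C(a,M;n)=\sum_{m\equiv a\pmod M}C(m,n)$. Let $p(n)$ be the number of partitions of $n$ ($p(0)=1$). The crank deviation is $D_C(a,M)=\sum_{n\ge0}\big(C(a,M;n)-p(n)/M\big)q^n$. *)

theory Defs
  imports "HOL-Analysis.Analysis" "HOL-Library.Multiset"
begin

definition qpoch :: "complex \<Rightarrow> complex \<Rightarrow> complex" where
  "qpoch x q = (\<Prod>i. 1 - q ^ i * x)"

definition jtheta :: "complex \<Rightarrow> complex \<Rightarrow> complex" where
  "jtheta x q = qpoch x q * qpoch (q / x) q * qpoch q q"

definition Jam :: "complex \<Rightarrow> int \<Rightarrow> nat \<Rightarrow> complex" where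
  "Jam q a m = jtheta (q powi a) (q ^ m)"

definition Jbar :: "complex \<Rightarrow> int \<Rightarrow> nat \<Rightarrow> complex" where
  "Jbar q a m = jtheta (- (q powi a)) (q ^ m)"

definition Jm :: "complex \<Rightarrow> nat \<Rightarrow> complex" where
  "Jm q m = Jam q (int m) (3 * m)"

definition partitions :: "nat \<Rightarrow> nat multiset set" where
  "partitions n = {P. (\<forall>x\<in>#P. x > 0) \<and> sum_mset P = n}"

definition npart :: "nat \<Rightarrow> nat" where
  "npart n = card (partitions n)"

definition crank :: "nat multiset \<Rightarrow> int" where
  "crank P = (if count P 1 = 0 then int (Max (set_mset P))
              else int (size (filter_mset (\<lambda>x. x > count P 1) P)) - int (count P 1))"

definition Ccrank :: "int \<Rightarrow> nat \<Rightarrow> int" where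
  "Ccrank m n =
     (if n = 0 then (if m = 0 then 1 else 0)
      else if n = 1 then (if m = 1 \<or> m = -1 then 1 else if m = 0 then -1 else 0)
      else int (card {P \<in> partitions n. crank P = m}))"

definition Cres :: "int \<Rightarrow> nat \<Rightarrow> nat \<Rightarrow> complex" where
  "Cres a M n = infsum (\<lambda>m. of_int (Ccrank m n)) {m. m mod int M = a mod int M}"

definition DC :: "int \<Rightarrow> nat \<Rightarrow> complex \<Rightarrow> complex" where
  "DC a M q = (\<Sum>n. (Cres a M n - of_nat (npart n) / of_nat M) * q ^ n)"

definition vartheta4 :: "complex \<Rightarrow> complex \<Rightarrow> complex \<Rightarrow> complex \<Rightarrow> complex \<Rightarrow> complex" where
  "vartheta4 q a0 a1 a2 a3 = 1 / (4 * Jm q 4) *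
     (a0 * Jbar q 4 8 * Jbar q 6 16 + a1 * q^2 * Jbar q 0 8 * Jbar q 14 16
      + a2 * q * Jbar q 4 8 * Jbar q 14 16 + a3 * q * Jbar q 0 8 * Jbar q 6 16)"

end

(*
  Averaging over the fourth roots of unity z turns D_C(a,4) into a combination of the crank products
  C(z,q) = (q)/((zq)(q/z)) at z = -1, i, -i, the contribution of z = 1 being cancelled by p(n)/4.
  The four theta products factor as (J_{4,8} - q J_{0,8})(J_{6,16} -+ q J_{14,16}) (J with a bar);
  by the 2-dissection of j(x;q), a consequence of Jacobi's triple product, the factors are j(q;q^2) and
  j(+-q;q^4), and their products divided by J_4 are C(-1,q) and C(i,q).
  The crank generating function is the theorem of Andrews and Garvan.
*)
theory Submission
  imports Defs
begin

section \<open>Infinite sums\<close>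

text \<open>Since q is a number and not an indeterminate, generating functions are unordered sums
  over multisets, and every regrouping needs absolute convergence. For the crank this is available
  on the circle \<open>norm z = 1\<close>: there the crank changes only the phase of a term, so
  partitions dominate the series, and the circle contains the roots of unity that are used. Two
  places need care. \<open>Ccrank\<close> counts partitions only from n = 2 on; the generating
  function differs from the sum over partitions at q^1, and the crank of the empty multiset is the
  maximum of an empty set. So the sum runs over nonempty partitions, and two explicit corrections
  are carried along until they cancel. The two-parameter coefficient \<open>qbinom_coeff\<close>
  serves twice: it supplies both Euler expansions behind the triple product and both series that
  arise when partitions are sorted for the crank.\<close>

lemma has_sum_mult_Times:
  fixes f :: "'a \<Rightarrow> 'c :: {real_normed_field, banach}" and g :: "'b \<Rightarrow> 'c"
  assumes fa: "(\<lambda>x. norm (f x)) summable_on A" and ga: "(\<lambda>y. norm (g y)) summable_on B"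
    and f: "(f has_sum a) A" and g: "(g has_sum b) B"
  shows "(\<lambda>(x, y). norm (f x * g y)) summable_on A \<times> B"
    and "((\<lambda>(x, y). f x * g y) has_sum a * b) (A \<times> B)"
proof -
  show abs: "(\<lambda>(x, y). norm (f x * g y)) summable_on A \<times> B"
  proof (rule summable_on_SigmaI)
    show "((\<lambda>y. case (x, y) of (x, y) \<Rightarrow> norm (f x * g y)) has_sum
            norm (f x) * infsum (\<lambda>y. norm (g y)) B) B" for x
      using has_sum_cmult_right[OF has_sum_infsum[OF ga], of "norm (f x)"] by (simp add: norm_mult)
    show "(\<lambda>x. norm (f x) * infsum (\<lambda>y. norm (g y)) B) summable_on A"
      by (rule summable_on_cmult_left[OF fa])
  qed auto
  have "(\<lambda>(x, y). f x * g y) summable_on A \<times> B"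
    by (rule abs_summable_summable) (use abs in \<open>simp add: case_prod_unfold\<close>)
  then obtain D where D: "((\<lambda>(x, y). f x * g y) has_sum D) (A \<times> B)"
    by (auto simp: summable_on_def)
  have "((\<lambda>x. f x * b) has_sum D) A"
    by (rule has_sum_Sigma[OF isUCont_plus D]) (use has_sum_cmult_right[OF g] in simp)
  moreover have "((\<lambda>x. f x * b) has_sum (a * b)) A"
    by (rule has_sum_cmult_left[OF f])
  ultimately have "D = a * b" by (rule has_sum_unique)
  thus "((\<lambda>(x, y). f x * g y) has_sum a * b) (A \<times> B)" using D by simp
qed

text \<open>Pairing x with h x identifies A with the disjoint union of the fibres of h. It is used
  to sort partitions by number of ones, by largest part and by size.\<close>

lemma has_sum_fibers:
  fixes f :: "'a \<Rightarrow> 'c :: banach"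
  assumes "(f has_sum S) A" and "\<And>j. (f has_sum g j) {x \<in> A. h x = j}"
  shows "(g has_sum S) UNIV"
proof -
  have "((\<lambda>(j, x). f x) has_sum S) (Sigma UNIV (\<lambda>j. {x \<in> A. h x = j})) \<longleftrightarrow> (f has_sum S) A"
    by (rule has_sum_reindex_bij_witness[where i = "\<lambda>x. (h x, x)" and j = snd]) auto
  with assms(1) have "((\<lambda>(j, x). f x) has_sum S) (Sigma UNIV (\<lambda>j. {x \<in> A. h x = j}))" by simp
  thus ?thesis by (rule has_sum_Sigma[OF isUCont_plus]) (use assms(2) in simp)
qed

section \<open>Infinite products and the \<open>q\<close>-binomial theorem\<close>

lemma qpoch_convergent:
  fixes q x :: complex
  assumes "norm q < 1"
  shows "convergent_prod (\<lambda>i. 1 - q ^ i * x)"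
proof -
  have "summable (\<lambda>i. norm (1 - q ^ i * x - 1))"
    using assms by (auto simp: norm_mult norm_power intro!: summable_mult2 summable_geometric)
  thus ?thesis
    by (intro abs_convergent_prod_imp_convergent_prod summable_imp_abs_convergent_prod)
qed

lemma qpoch_has_prod: "norm q < 1 \<Longrightarrow> (\<lambda>i. 1 - q ^ i * x) has_prod qpoch x q"
  unfolding qpoch_def by (intro convergent_prod_has_prod qpoch_convergent)

lemma qpoch_LIMSEQ: "norm q < 1 \<Longrightarrow> (\<lambda>n. \<Prod>i<n. 1 - q ^ i * x) \<longlonglongrightarrow> qpoch x q"
  by (intro has_prod_imp_tendsto' qpoch_has_prod)

lemma qpoch_eq_0_iff: "norm q < 1 \<Longrightarrow> qpoch x q = 0 \<longleftrightarrow> (\<exists>i. q ^ i * x = 1)"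
  using has_prod_eq_0_iff[OF qpoch_has_prod, of q x] by auto

lemma qpoch_nonzero:
  assumes "norm q < 1" "norm x < 1"
  shows "qpoch x q \<noteq> 0"
proof -
  have "norm (q ^ i * x) < 1" for i
  proof -
    have "norm q ^ i * norm x \<le> 1 * norm x"
      using assms by (intro mult_right_mono power_le_one) auto
    thus ?thesis using assms by (simp add: norm_mult norm_power)
  qed
  thus ?thesis using qpoch_eq_0_iff[OF assms(1), of x]
    by (metis less_irrefl norm_one)
qed

lemma qpoch_0 [simp]: "qpoch 0 q = 1"
  by (simp add: qpoch_def)

lemma qpoch_split:
  assumes "norm q < 1"
  shows "qpoch x q = (\<Prod>i<n. 1 - q ^ i * x) * qpoch (q ^ n * x) q"
proof -
  have "(\<lambda>i. 1 - q ^ i * x) has_prod ((\<Prod>k<n. 1 - q ^ k * x) * (\<Prod>k. 1 - q ^ (k + n) * x))"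
    by (intro has_prod_ignore_initial_segment' qpoch_convergent assms)
  hence "qpoch x q = (\<Prod>k<n. 1 - q ^ k * x) * (\<Prod>k. 1 - q ^ (k + n) * x)"
    unfolding qpoch_def by (rule has_prod_unique[symmetric])
  thus ?thesis by (simp add: qpoch_def power_add mult.assoc)
qed

text \<open>The factors are sorted by the residue of i modulo m. Passing to the limit along N * m
  factors keeps every rearrangement finite.\<close>

lemma qpoch_dissect:
  assumes "norm q < 1" "m > 0"
  shows "qpoch x q = (\<Prod>r<m. qpoch (q ^ r * x) (q ^ m))"
proof -
  have qm: "norm (q ^ m) < 1"
    using assms by (simp add: norm_power power_less_one_iff)
  have lim: "(\<lambda>N. \<Prod>i<N * m. 1 - q ^ i * x) \<longlonglongrightarrow> qpoch x q"
    using filterlim_compose[OF qpoch_LIMSEQ[OF assms(1)] mult_nat_right_at_top[OF assms(2)]] .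
  have eq: "(\<Prod>i<N * m. 1 - q ^ i * x) = (\<Prod>r<m. \<Prod>i<N. 1 - (q ^ m) ^ i * (q ^ r * x))" for N
  proof -
    have "(\<Prod>i<N * m. 1 - q ^ i * x) = (\<Prod>i<N. \<Prod>r<m. 1 - q ^ (r + i * m) * x)"
    proof (induction N)
      case (Suc N)
      have "(\<Prod>i<Suc N * m. 1 - q ^ i * x) =
            (\<Prod>i<N * m. 1 - q ^ i * x) * (\<Prod>i=N * m..<N * m + m. 1 - q ^ i * x)"
        by (subst prod.atLeastLessThan_concat[of 0, symmetric, unfolded lessThan_atLeast0[symmetric]])
           (auto simp: lessThan_atLeast0 add.commute prod.atLeastLessThan_concat)
      also have "(\<Prod>i=N * m..<N * m + m. 1 - q ^ i * x) = (\<Prod>r<m. 1 - q ^ (r + N * m) * x)"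
        using prod.shift_bounds_nat_ivl[of "\<lambda>i. 1 - q ^ i * x" 0 "N * m" m]
        by (simp add: lessThan_atLeast0 add.commute)
      finally show ?case using Suc.IH by simp
    qed simp
    also have "\<dots> = (\<Prod>r<m. \<Prod>i<N. 1 - q ^ (r + i * m) * x)"
      by (rule prod.swap)
    also have "\<dots> = (\<Prod>r<m. \<Prod>i<N. 1 - (q ^ m) ^ i * (q ^ r * x))"
      by (simp add: power_add power_mult[symmetric] mult_ac)
    finally show ?thesis .
  qed
  have "(\<lambda>N. \<Prod>r<m. \<Prod>i<N. 1 - (q ^ m) ^ i * (q ^ r * x)) \<longlonglongrightarrow> (\<Prod>r<m. qpoch (q ^ r * x) (q ^ m))"
    by (intro tendsto_prod qpoch_LIMSEQ qm)
  thus ?thesis using lim unfolding eq by (rule LIMSEQ_unique[symmetric])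
qed

lemma qpoch_dissect2: "norm q < 1 \<Longrightarrow> qpoch x q = qpoch x (q\<^sup>2) * qpoch (q * x) (q\<^sup>2)"
  using qpoch_dissect[of q 2 x] by (simp add: numeral_2_eq_2)

lemma qpoch_dissect3:
  "norm q < 1 \<Longrightarrow> qpoch x q = qpoch x (q ^ 3) * qpoch (q * x) (q ^ 3) * qpoch (q\<^sup>2 * x) (q ^ 3)"
  using qpoch_dissect[of q 3 x] by (simp add: numeral_3_eq_3 numeral_2_eq_2 mult.assoc)

lemma qpoch_mult_uminus:
  assumes "norm q < 1"
  shows "qpoch x q * qpoch (- x) q = qpoch (x\<^sup>2) (q\<^sup>2)"
proof -
  have q2: "norm (q\<^sup>2) < 1" using assms by (simp add: norm_power power_less_one_iff)
  have "(\<lambda>n. (\<Prod>i<n. 1 - q ^ i * x) * (\<Prod>i<n. 1 - q ^ i * (- x))) \<longlonglongrightarrow> qpoch x q * qpoch (- x) q"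
    by (intro tendsto_mult qpoch_LIMSEQ assms)
  also have "(\<lambda>n. (\<Prod>i<n. 1 - q ^ i * x) * (\<Prod>i<n. 1 - q ^ i * (- x))) =
             (\<lambda>n. \<Prod>i<n. 1 - (q\<^sup>2) ^ i * x\<^sup>2)"
    by (intro ext, subst prod.distrib[symmetric], intro prod.cong)
       (auto simp: power2_eq_square algebra_simps power_mult_distrib)
  finally show ?thesis using qpoch_LIMSEQ[OF q2, of "x\<^sup>2"] by (rule LIMSEQ_unique)
qed

text \<open>
  For \<open>\<alpha> = 1\<close> this is the \<open>q\<close>-binomial theorem, with Euler's expansion of the reciprocal product at
  \<open>\<beta> = 0\<close>; for \<open>\<alpha> = 0\<close> and \<open>\<beta> = 1\<close> it is Euler's expansion of the product itself. The recurrence of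
  the coefficients says \<open>(1 - \<alpha> y) G(y) = (1 - \<beta> y) G(q y)\<close> for the sum \<open>G\<close>, which is then iterated.
\<close>

definition qbinom_coeff :: "complex \<Rightarrow> complex \<Rightarrow> complex \<Rightarrow> nat \<Rightarrow> complex" where
  "qbinom_coeff \<alpha> \<beta> q n = (\<Prod>i<n. (\<alpha> - \<beta> * q ^ i) / (1 - q ^ Suc i))"

lemma one_minus_power_nonzero:
  fixes q :: complex
  assumes "norm q < 1"
  shows "1 - q ^ Suc i \<noteq> 0"
  using assms by (metis norm_one norm_power power_less_one_iff norm_ge_zero zero_less_Suc
      eq_iff_diff_eq_0 less_irrefl)

lemma qbinom_coeff_Suc:
  assumes "norm q < 1"
  shows "qbinom_coeff \<alpha> \<beta> q (Suc n) * (1 - q ^ Suc n) = qbinom_coeff \<alpha> \<beta> q n * (\<alpha> - \<beta> * q ^ n)"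
  using one_minus_power_nonzero[OF assms, of n] by (simp add: qbinom_coeff_def)

text \<open>In a q-series the quotient of consecutive terms depends on n only through q^n and so has
  a limit; from some index on its norm is below the midpoint \<open>c\<close> of
  \<open>norm L\<close> and 1.\<close>

lemma summable_norm_ratio_limit:
  fixes f :: "nat \<Rightarrow> complex"
  assumes "\<And>n. f (Suc n) = r n * f n" and lim: "r \<longlonglongrightarrow> L" and "norm L < 1"
  shows "summable (\<lambda>n. norm (f n))"
proof -
  define c where "c = (1 + norm L) / 2"
  have c: "norm L < c" "c < 1" using assms(3) by (auto simp: c_def)
  from order_tendstoD(2)[OF tendsto_norm[OF lim] c(1)] obtain N where
    N: "norm (r n) < c" if "n \<ge> N" for n
    by (auto simp: eventually_at_top_linorder)
  show ?thesis
  proof (rule summable_ratio_test[OF c(2), of N])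
    fix n assume "n \<ge> N"
    thus "norm (norm (f (Suc n))) \<le> c * norm (norm (f n))"
      using mult_right_mono[OF less_imp_le[OF N[OF \<open>n \<ge> N\<close>]] norm_ge_zero[of "f n"]]
      by (simp add: assms(1) norm_mult)
  qed
qed

lemma summable_qbinom:
  assumes "norm q < 1" "norm (\<alpha> * x) < 1"
  shows "summable (\<lambda>n. norm (qbinom_coeff \<alpha> \<beta> q n * x ^ n))"
proof (rule summable_norm_ratio_limit)
  have pow: "(\<lambda>n. q ^ n) \<longlonglongrightarrow> 0" using assms(1) by (rule LIMSEQ_power_zero)
  show "(\<lambda>n. (\<alpha> - \<beta> * q ^ n) / (1 - q ^ Suc n) * x) \<longlonglongrightarrow> (\<alpha> - \<beta> * 0) / (1 - 0) * x"
    by (intro tendsto_intros pow LIMSEQ_Suc[OF pow]) auto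
qed (use assms in \<open>auto simp: qbinom_coeff_def\<close>)

theorem qbinomial_theorem:
  assumes "norm q < 1" "norm (\<alpha> * x) < 1"
  shows "((\<lambda>n. qbinom_coeff \<alpha> \<beta> q n * x ^ n) has_sum (qpoch (\<beta> * x) q / qpoch (\<alpha> * x) q)) UNIV"
proof -
  let ?c = "qbinom_coeff \<alpha> \<beta> q"
  define G where "G = (\<lambda>y. \<Sum>n. ?c n * y ^ n)"
  have sm: "summable (\<lambda>n. ?c n * y ^ n)" if "norm y \<le> norm x" for y
  proof -
    have "norm (\<alpha> * y) < 1"
      using that assms(2) mult_left_mono[OF that, of "norm \<alpha>"] by (simp add: norm_mult)
    thus ?thesis by (rule summable_norm_cancel[OF summable_qbinom[OF assms(1)]])
  qed
  have "G x = qpoch (\<beta> * x) q / qpoch (\<alpha> * x) q"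
  \<comment> \<open>Continuity of \<open>G\<close> at 0 will be drawn from convergence at the point
    x, which requires \<open>norm x > 0\<close>.\<close>
  proof (cases "x = 0")
    case True
    thus ?thesis by (simp add: G_def qbinom_coeff_def)
  next
    case x: False
    have fe: "(1 - \<alpha> * y) * G y = (1 - \<beta> * y) * G (q * y)" if y: "norm y \<le> norm x" for y
    proof -
      have qy: "norm (q * y) \<le> norm x"
        using y assms(1) mult_mono[of "norm q" 1 "norm y" "norm x"] by (simp add: norm_mult)
      note s1 = summable_sums[OF sm[OF y], folded G_def]
      note s2 = summable_sums[OF sm[OF qy]]
      have G1: "(\<lambda>n. ?c n * y ^ n) sums G y" and G2: "(\<lambda>n. ?c n * (q * y) ^ n) sums G (q * y)"
        using s1 s2 by (auto simp: G_def)
      \<comment> \<open>Subtracting the series at q y produces the factor \<open>1 - q ^ n\<close>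
        of the coefficient recurrence and removes the constant term, so the index can be
        shifted.\<close>
      have L: "(\<lambda>n. ?c n * y ^ n - ?c n * (q * y) ^ n) sums (G y - G (q * y))"
        by (intro sums_diff G1 G2)
      have "(\<lambda>n. y * (\<alpha> * (?c n * y ^ n) - \<beta> * (?c n * (q * y) ^ n))) sums
              (y * (\<alpha> * G y - \<beta> * G (q * y)))"
        by (intro sums_mult sums_diff G1 G2)
      also have "(\<lambda>n. y * (\<alpha> * (?c n * y ^ n) - \<beta> * (?c n * (q * y) ^ n))) =
                 (\<lambda>n. ?c (Suc n) * y ^ Suc n - ?c (Suc n) * (q * y) ^ Suc n)"
      proof
        fix n
        have "?c (Suc n) * y ^ Suc n - ?c (Suc n) * (q * y) ^ Suc n =
              ?c (Suc n) * (1 - q ^ Suc n) * y ^ Suc n"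
          by (simp add: algebra_simps power_mult_distrib)
        also have "\<dots> = ?c n * (\<alpha> - \<beta> * q ^ n) * y ^ Suc n"
          by (simp only: qbinom_coeff_Suc[OF assms(1)])
        finally show "y * (\<alpha> * (?c n * y ^ n) - \<beta> * (?c n * (q * y) ^ n)) =
            ?c (Suc n) * y ^ Suc n - ?c (Suc n) * (q * y) ^ Suc n"
          by (simp add: algebra_simps power_mult_distrib)
      qed
      finally have "(\<lambda>n. ?c n * y ^ n - ?c n * (q * y) ^ n) sums (y * (\<alpha> * G y - \<beta> * G (q * y)))"
        by (subst (asm) sums_Suc_iff) simp
      from sums_unique2[OF this L] show ?thesis
        by (simp add: algebra_simps)
    qed
    have nz: "qpoch (\<alpha> * x) q \<noteq> 0"
      using assms by (intro qpoch_nonzero)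
    have small: "norm (q ^ N * x) \<le> norm x" for N
      using assms(1) by (simp add: norm_mult norm_power mult_left_le_one_le power_le_one)
    have it: "(\<Prod>i<N. 1 - q ^ i * (\<alpha> * x)) * G x = (\<Prod>i<N. 1 - q ^ i * (\<beta> * x)) * G (q ^ N * x)" for N
    proof (induction N)
      case (Suc N)
      have "(1 - q ^ N * (\<alpha> * x)) * G (q ^ N * x) = (1 - q ^ N * (\<beta> * x)) * G (q ^ Suc N * x)"
        using fe[OF small[of N]] by (simp add: mult_ac)
      thus ?case using Suc.IH
        by (simp only: prod.lessThan_Suc) (metis (no_types, lifting) mult.assoc mult.left_commute)
    qed simp
    have "isCont G 0"
      unfolding G_def using x by (intro isCont_powser[OF sm[OF order.refl]]) auto
    moreover have "(\<lambda>N. q ^ N * x) \<longlonglongrightarrow> 0"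
      using LIMSEQ_power_zero[OF assms(1)] by (intro tendsto_mult_left_zero)
    ultimately have "(\<lambda>N. G (q ^ N * x)) \<longlonglongrightarrow> G 0"
      by (rule isCont_tendsto_compose)
    moreover have "G 0 = 1" by (simp add: G_def qbinom_coeff_def)
    ultimately have "(\<lambda>N. (\<Prod>i<N. 1 - q ^ i * (\<beta> * x)) * G (q ^ N * x)) \<longlonglongrightarrow> qpoch (\<beta> * x) q * 1"
      by (intro tendsto_mult qpoch_LIMSEQ assms(1)) auto
    moreover have "(\<lambda>N. (\<Prod>i<N. 1 - q ^ i * (\<alpha> * x)) * G x) \<longlonglongrightarrow> qpoch (\<alpha> * x) q * G x"
      by (intro tendsto_mult qpoch_LIMSEQ assms(1) tendsto_const)
    ultimately have "qpoch (\<alpha> * x) q * G x = qpoch (\<beta> * x) q"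
      using LIMSEQ_unique unfolding it by fastforce
    thus ?thesis using nz by (simp add: field_simps)
  qed
  moreover have "(\<lambda>n. ?c n * x ^ n) sums G x"
    unfolding G_def by (intro summable_sums sm) simp
  ultimately show ?thesis
    by (intro norm_summable_imp_has_sum summable_qbinom assms) simp
qed

section \<open>Jacobi triple product\<close>

definition theta_term :: "complex \<Rightarrow> complex \<Rightarrow> int \<Rightarrow> complex" where
  "theta_term x q n = (-1) powi n * q powi (n * (n - 1) div 2) * x powi n"

lemma triangular_add:
  fixes m n :: int
  shows "(m + n) * (m + n - 1) div 2 = m * (m - 1) div 2 + n * (n - 1) div 2 + m * n"
proof -
  have "even (m * (m - 1))" "even (n * (n - 1))" by auto
  then obtain a b where ab: "m * (m - 1) = 2 * a" "n * (n - 1) = 2 * b" by (elim evenE)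
  have "(m + n) * (m + n - 1) = m * (m - 1) + n * (n - 1) + 2 * (m * n)"
    by (simp add: algebra_simps)
  also have "\<dots> = 2 * (a + b + m * n)" by (simp add: ab)
  finally show ?thesis by (simp add: ab)
qed

lemma triangular_double:
  fixes k :: int
  shows "2 * k * (2 * k - 1) div 2 = 4 * (k * (k - 1) div 2) + k"
proof -
  have "even (k * (k - 1))" by auto
  then obtain a where a: "k * (k - 1) = 2 * a" by (elim evenE)
  have "2 * k * (2 * k - 1) = 4 * (k * (k - 1)) + 2 * k"
    by (simp add: algebra_simps)
  also have "\<dots> = 2 * (4 * a + k)" by (simp add: a)
  finally show ?thesis by (simp add: a)
qed

lemma theta_term_Suc:
  assumes "q \<noteq> 0" "x \<noteq> 0"
  shows "theta_term x q (n + 1) = - (q powi n) * x * theta_term x q n"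
proof -
  have "(n + 1) * (n + 1 - 1) div 2 = n * (n - 1) div 2 + n"
    using triangular_add[of n 1] by simp
  thus ?thesis using assms by (simp add: theta_term_def power_int_add)
qed

text \<open>The ratio of consecutive terms tends to 0 in both directions: it is -q^n x upwards and
  -q^(n+1)/x downwards. Hence any nonzero x is admissible.\<close>

lemma theta_term_summable:
  assumes "q \<noteq> 0" "norm q < 1" "x \<noteq> 0"
  shows "(\<lambda>n. norm (theta_term x q n)) summable_on UNIV"
proof -
  have pow: "(\<lambda>n. q ^ n) \<longlonglongrightarrow> 0" using assms(2) by (rule LIMSEQ_power_zero)
  have "summable (\<lambda>n. norm (theta_term x q (int n)))"
  proof (rule summable_norm_ratio_limit)
    show "theta_term x q (int (Suc n)) = - (q ^ n) * x * theta_term x q (int n)" for n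
      using theta_term_Suc[OF assms(1,3), of "int n"] by (simp add: add.commute)
    show "(\<lambda>n. - (q ^ n) * x) \<longlonglongrightarrow> - 0 * x"
      by (intro tendsto_intros pow)
  qed simp
  hence 1: "(\<lambda>n. norm (theta_term x q n)) summable_on range int"
    by (subst summable_on_reindex) (auto simp: o_def intro!: norm_summable_imp_summable_on)
  have "summable (\<lambda>n. norm (theta_term x q (- int n)))"
  proof (rule summable_norm_ratio_limit)
    show "theta_term x q (- int (Suc n)) = - (q ^ Suc n) / x * theta_term x q (- int n)" for n
    proof -
      have "- int n = - int (Suc n) + 1" by simp
      hence "theta_term x q (- int n) = - (q powi (- int (Suc n))) * x * theta_term x q (- int (Suc n))"
        using theta_term_Suc[OF assms(1,3), of "- int (Suc n)"] by simp
      also have "q powi (- int (Suc n)) = inverse (q ^ Suc n)"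
        by (simp only: power_int_minus power_int_of_nat)
      finally show ?thesis using assms by (simp add: field_simps)
    qed
    show "(\<lambda>n. - (q ^ Suc n) / x) \<longlonglongrightarrow> - 0 / x"
      by (intro tendsto_intros LIMSEQ_Suc[OF pow] assms)
  qed simp
  hence 2: "(\<lambda>n. norm (theta_term x q n)) summable_on range (\<lambda>n. - int n)"
    by (subst summable_on_reindex) (auto simp: o_def inj_on_def intro!: norm_summable_imp_summable_on)
  have "(UNIV :: int set) = range int \<union> range (\<lambda>n. - int n)"
    by (auto simp: image_iff) (metis int_cases2)
  thus ?thesis using summable_on_union[OF 1 2] by simp
qed

lemma prod_uminus_power:
  assumes "q \<noteq> (0 :: complex)"
  shows "(\<Prod>i<m. - (q ^ i)) = (-1) ^ m * q powi (int m * (int m - 1) div 2)"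
proof (induction m)
  case (Suc m)
  have "int (Suc m) * (int (Suc m) - 1) div 2 = int m * (int m - 1) div 2 + int m"
    using triangular_add[of "int m" 1] by (simp add: add.commute)
  thus ?case using Suc assms by (simp add: power_int_add del: of_nat_Suc)
qed simp

text \<open>Euler's two expansions have the same denominators; the numerators of one are the factors
  -q^i, whose product is the sign and Gaussian power found in a theta term.\<close>

lemma qbinom_coeff_0_1:
  assumes "q \<noteq> 0"
  shows "qbinom_coeff 0 1 q m =
           (-1) ^ m * q powi (int m * (int m - 1) div 2) * qbinom_coeff 1 0 q m"
  unfolding prod_uminus_power[OF assms, symmetric] qbinom_coeff_def
  by (simp add: prod.distrib[symmetric] divide_inverse)

text \<open>
  Andrews' proof: both products \<open>(x;q)\<close> and \<open>(q\<^sup>n\<^sup>+\<^sup>1;q)\<close> are expanded by Euler's formula; the latter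
  vanishes for negative \<open>n\<close>, so the outer sum may run over all integers. Shifting its index by the
  inner one makes the double sum factor.
\<close>

lemma jacobi_triple_product_aux:
  assumes "q \<noteq> 0" "norm q < 1" "norm q < norm x"
  shows "(theta_term x q has_sum jtheta x q) UNIV"
proof -
  have x: "x \<noteq> 0" using assms by auto
  \<comment> \<open>The restriction \<open>norm q < norm x\<close> is made for this: Euler's series
    for the reciprocal of (q/x;q) needs an argument of modulus below 1.\<close>
  have qx: "norm (q / x) < 1" using assms x by (simp add: norm_divide)
  let ?t = "theta_term x q"
  define b where "b m = qbinom_coeff 1 0 q m * (q / x) ^ m" for m
  define S where "S = infsum ?t UNIV"
  have tS: "(?t has_sum S) UNIV"
    unfolding S_def
    by (rule has_sum_infsum[OF abs_summable_summable[OF theta_term_summable[OF assms(1,2) x]]])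
  have b: "(b has_sum (1 / qpoch (q / x) q)) UNIV"
    using qbinomial_theorem[OF assms(2), of 1 "q / x" 0] qx unfolding b_def by simp
  have babs: "(\<lambda>m. norm (b m)) summable_on UNIV"
    using summable_qbinom[OF assms(2), of 1 "q / x" 0] qx unfolding b_def
    by (intro norm_summable_imp_summable_on) simp
  define D where "D = S * (1 / qpoch (q / x) q)"
  have D: "((\<lambda>(n, m). ?t n * b m) has_sum D) (UNIV \<times> UNIV)"
    unfolding D_def
    by (rule has_sum_mult_Times(2)[OF theta_term_summable[OF assms(1,2) x] babs tS b])
  define a where "a n m = ?t n * (qbinom_coeff 0 1 q m * (q powi (n + 1)) ^ m)" for n m
  have "((\<lambda>(n, m). a n m) has_sum D) (UNIV \<times> UNIV)"
  proof (subst has_sum_reindex_bij_witness[where i = "\<lambda>(n, m). (n - int m, m)"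
        and j = "\<lambda>(n, m). (n + int m, m)" and T = "UNIV \<times> UNIV" and h = "\<lambda>(n, m). ?t n * b m"])
    show "(case case p of (n, m) \<Rightarrow> (n + int m, m) of (n, m) \<Rightarrow> ?t n * b m) =
          (case p of (n, m) \<Rightarrow> a n m)" for p
    proof (cases p)
      case (Pair n m)
      \<comment> \<open>The cross term of binom(n+m,2) is what (q^(n+1))^m contributes, up to the
        power q^m that goes into (q/x)^m. This is why shifting by m separates the variables.\<close>
      have ex: "(n + int m) * (n + int m - 1) div 2 + int m =
            n * (n - 1) div 2 + int m * (int m - 1) div 2 + (n + 1) * int m"
        using triangular_add[of n "int m"] by (simp add: algebra_simps)
      have "a n m = (-1) powi n * (-1) ^ m * (q powi (n * (n - 1) div 2)
            * q powi (int m * (int m - 1) div 2) * q powi ((n + 1) * int m))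
            * x powi n * qbinom_coeff 1 0 q m"
        using power_int_mult[of q "n + 1" "int m"]
        unfolding a_def theta_term_def qbinom_coeff_0_1[OF assms(1)] by (simp add: mult_ac)
      also have "\<dots> = (-1) powi n * (-1) ^ m * q powi (n * (n - 1) div 2 + int m * (int m - 1) div 2
            + (n + 1) * int m) * x powi n * qbinom_coeff 1 0 q m"
        using assms(1) by (simp only: power_int_add simp_thms)
      also have "\<dots> = ?t (n + int m) * b m"
        unfolding ex[symmetric] theta_term_def b_def using assms(1) x
        by (simp add: power_int_add power_divide)
      finally show ?thesis using Pair by simp
    qed
  qed (use D in auto)
  hence "((\<lambda>n. ?t n * qpoch (q powi (n + 1)) q) has_sum D) UNIV"
  proof (rule has_sum_Sigma')
    show "((\<lambda>m. case (n, m) of (n, m) \<Rightarrow> a n m) has_sum ?t n * qpoch (q powi (n + 1)) q) UNIV" for n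
      using has_sum_cmult_right[OF qbinomial_theorem[OF assms(2), of 0 "q powi (n + 1)" 1], of "?t n"]
      by (simp add: a_def)
  qed
  also have "?this \<longleftrightarrow> ((\<lambda>n. ?t n * qpoch (q powi (n + 1)) q) has_sum D) (range int)"
  proof (rule has_sum_cong_neutral)
    fix n :: int assume "n \<in> UNIV - range int"
    hence "n < 0" by (metis DiffE int_eq_iff not_less rangeI)
    have "q ^ nat (- n - 1) * q powi (n + 1) = q powi (int (nat (- n - 1)) + (n + 1))"
      using assms(1) by (simp only: power_int_add[OF disjI1] power_int_of_nat not_False_eq_True)
    also have "\<dots> = 1" using \<open>n < 0\<close> by simp
    finally have "qpoch (q powi (n + 1)) q = 0"
      using qpoch_eq_0_iff[OF assms(2)] by blast
    thus "?t n * qpoch (q powi (n + 1)) q = 0" by simp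
  qed auto
  also have "\<dots> \<longleftrightarrow> ((\<lambda>n. ?t (int n) * qpoch (q powi (int n + 1)) q) has_sum D) UNIV"
    by (subst has_sum_reindex) (auto simp: o_def)
  also have "(\<lambda>n. ?t (int n) * qpoch (q powi (int n + 1)) q) =
             (\<lambda>n. qpoch q q * (qbinom_coeff 0 1 q n * x ^ n))"
  proof
    fix n
    have "q powi (int n + 1) = q ^ n * q"
      using assms(1) by (simp add: power_int_add)
    \<comment> \<open>(q^(n+1);q) is (q;q) without its first n factors, and these factors are
      exactly the denominators of Euler's coefficient.\<close>
    moreover have "qpoch q q = (\<Prod>i<n. 1 - q ^ i * q) * qpoch (q ^ n * q) q"
      by (rule qpoch_split[OF assms(2)])
    moreover have "(\<Prod>i<n. 1 - q ^ i * q) * qbinom_coeff 1 0 q n = 1"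
      unfolding qbinom_coeff_def prod.distrib[symmetric]
      using one_minus_power_nonzero[OF assms(2)] by (intro prod.neutral) (auto simp: mult.commute)
    ultimately show "?t (int n) * qpoch (q powi (int n + 1)) q =
             qpoch q q * (qbinom_coeff 0 1 q n * x ^ n)"
      unfolding qbinom_coeff_0_1[OF assms(1)] theta_term_def
      by (simp add: mult_ac)
  qed
  finally have "D = qpoch q q * qpoch x q"
    using has_sum_cmult_right[OF qbinomial_theorem[OF assms(2), of 0 x 1], of "qpoch q q"]
    by (auto dest: has_sum_unique)
  hence "S = jtheta x q"
    using D_def qpoch_nonzero[OF assms(2) qx] by (simp add: jtheta_def field_simps)
  thus ?thesis using tS by simp
qed

lemma jtheta_reflect:
  assumes "q \<noteq> 0" "x \<noteq> 0"
  shows "jtheta (q / x) q = jtheta x q"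
  using assms by (simp add: jtheta_def)

text \<open>If \<open>norm x\<close> is at most \<open>norm q\<close>, then q/x has modulus at least
  1 and falls under the case already proved. Both sides are invariant under x -> q/x, the series by
  n -> -n.\<close>

theorem jacobi_triple_product:
  assumes "q \<noteq> 0" "norm q < 1" "x \<noteq> 0"
  shows "(theta_term x q has_sum jtheta x q) UNIV"
proof (cases "norm q < norm x")
  case True
  thus ?thesis by (intro jacobi_triple_product_aux assms)
next
  case False
  hence "norm q < norm (q / x)"
  proof -
    have "norm q * norm x \<le> norm q * norm q"
      using False by (intro mult_left_mono) auto
    also have "\<dots> < norm q * 1"
      using assms by (intro mult_strict_left_mono) auto
    finally show ?thesis using assms by (simp add: norm_divide divide_simps)
  qed
  hence "(theta_term (q / x) q has_sum jtheta x q) UNIV"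
    using jacobi_triple_product_aux[OF assms(1,2), of "q / x"] jtheta_reflect[OF assms(1,3)] by simp
  also have "?this \<longleftrightarrow> ?thesis"
  proof (rule has_sum_reindex_bij_witness[where i = uminus and j = uminus])
    fix n :: int
    have "n * (n - 1) div 2 + n = (n * (n - 1) + n * 2) div 2" by simp
    also have "n * (n - 1) + n * 2 = - n * (- n - 1)" by (simp add: algebra_simps)
    finally have "n * (n - 1) div 2 + n = - n * (- n - 1) div 2" .
    hence "q powi (- n * (- n - 1) div 2) = q powi (n * (n - 1) div 2) * q powi n"
      using assms by (metis power_int_add)
    thus "theta_term x q (- n) = theta_term (q / x) q n"
      using assms unfolding theta_term_def power_int_minus_one_minus
      by (simp add: power_int_minus power_int_mult_distrib power_int_inverse divide_inverse)
  qed auto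
  finally show ?thesis .
qed

text \<open>The terms with n = 2k and with n = 2k + 1 form triple product series again: binom(2k,2)
  = 4 binom(k,2) + k gives the base q^4. The minus signs in the arguments cancel the (-1)^k of the
  new series, since the parity of n is constant in each half.\<close>

lemma jtheta_dissect2:
  assumes "q \<noteq> 0" "norm q < 1" "x \<noteq> 0"
  shows "jtheta x q = jtheta (- (q * x\<^sup>2)) (q ^ 4) - x * jtheta (- (q ^ 3 * x\<^sup>2)) (q ^ 4)"
proof -
  have q4: "q ^ 4 \<noteq> 0" "norm (q ^ 4) < 1"
    using assms by (auto simp: norm_power power_less_one_iff)
  let ?e = "\<lambda>k. 2 * k :: int" and ?o = "\<lambda>k. 2 * k + 1 :: int"
  have pw: "y powi (2 * k) = (y ^ 2) powi k" for y :: complex and k :: int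
    by (simp add: power_int_mult)
  have q4p: "(q ^ 4) powi k = q powi (4 * k)" for k :: int
    by (simp add: power_int_mult)
  have ev: "theta_term x q (?e k) = theta_term (- (q * x\<^sup>2)) (q ^ 4) k" for k
  proof -
    have "?e k * (?e k - 1) div 2 = 4 * (k * (k - 1) div 2) + k"
      by (rule triangular_double)
    thus ?thesis using assms unfolding theta_term_def q4p
      by (simp add: power_int_add pw power_int_mult_distrib power_int_minus_left)
  qed
  have od: "theta_term x q (?o k) = - x * theta_term (- (q ^ 3 * x\<^sup>2)) (q ^ 4) k" for k
  proof -
    have "?o k * (?o k - 1) div 2 = 4 * (k * (k - 1) div 2) + 3 * k"
      using triangular_double[of k] triangular_add[of "2 * k" 1] by simp
    moreover have "(q ^ 3) powi k = q powi (3 * k)" by (simp add: power_int_mult)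
    ultimately show ?thesis using assms unfolding theta_term_def q4p
      by (simp add: power_int_add pw power_int_mult_distrib power_int_minus_left)
  qed
  have Ev: "(theta_term x q has_sum jtheta (- (q * x\<^sup>2)) (q ^ 4)) (range ?e)"
    using jacobi_triple_product[OF q4, of "- (q * x\<^sup>2)"] assms
    by (subst has_sum_reindex) (auto simp: o_def ev inj_on_def)
  have Od: "(theta_term x q has_sum (- x * jtheta (- (q ^ 3 * x\<^sup>2)) (q ^ 4))) (range ?o)"
    using has_sum_cmult_right[OF jacobi_triple_product[OF q4, of "- (q ^ 3 * x\<^sup>2)"], of "- x"] assms
    by (subst has_sum_reindex) (auto simp: o_def od inj_on_def)
  have "range ?e \<inter> range ?o = {}" by (auto, presburger)
  moreover have "range ?e \<union> range ?o = UNIV" by (auto simp: image_iff) presburger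
  ultimately have "(theta_term x q has_sum (jtheta (- (q * x\<^sup>2)) (q ^ 4) +
      (- x * jtheta (- (q ^ 3 * x\<^sup>2)) (q ^ 4)))) UNIV"
    using has_sum_Un_disjoint[OF Ev Od] by simp
  from has_sum_unique[OF jacobi_triple_product[OF assms] this] show ?thesis by simp
qed

section \<open>Theta quotients\<close>

lemma norm_power_less_one:
  fixes q :: complex
  assumes "norm q < 1" "n > 0"
  shows "norm (q ^ n) < 1"
  using assms by (simp add: norm_power power_less_one_iff)

text \<open>Euler's identity between odd and distinct parts: (q;q)(-q;q) equals (q^2;q^2), which is
  also the cofactor of (q;q^2) in (q;q).\<close>

lemma euler_odd_distinct:
  assumes "norm q < 1"
  shows "qpoch q (q\<^sup>2) * qpoch (- q) q = 1"
proof -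
  have "qpoch q q \<noteq> 0" using assms by (intro qpoch_nonzero)
  moreover have "qpoch q (q\<^sup>2) * qpoch (- q) q * qpoch q q = qpoch q q"
    using qpoch_dissect2[OF assms, of q] qpoch_mult_uminus[OF assms, of q]
    by (simp add: power2_eq_square mult_ac)
  ultimately show ?thesis by simp
qed

definition crank_prod :: "complex \<Rightarrow> complex \<Rightarrow> complex" where
  "crank_prod z q = qpoch q q / (qpoch (z * q) q * qpoch (q / z) q)"

lemma crank_prod_minus_one:
  assumes "norm q < 1"
  shows "crank_prod (-1) q = qpoch q q * (qpoch q (q\<^sup>2))\<^sup>2"
proof -
  have "qpoch (- q) q \<noteq> 0" using euler_odd_distinct[OF assms] by auto
  moreover from this have "qpoch q (q\<^sup>2) = 1 / qpoch (- q) q"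
    using euler_odd_distinct[OF assms] by (simp add: field_simps)
  ultimately show ?thesis
    by (simp add: crank_prod_def power2_eq_square)
qed

text \<open>Since 1/z = -z, the two denominators are (zq;q) and (-zq;q) and multiply to (-q^2;q^2).
  Euler's identity in base q^2 inverts this to (q^2;q^4), which splits into (q;q^2)(-q;q^2). The
  result is the same for both choices of z.\<close>

lemma crank_prod_i:
  assumes "norm q < 1" "z = \<i> \<or> z = - \<i>"
  shows "crank_prod z q = qpoch q q * (qpoch q (q\<^sup>2) * qpoch (- q) (q\<^sup>2))"
proof -
  have q2: "norm (q\<^sup>2) < 1" using assms by (intro norm_power_less_one) auto
  have zz: "z * z = -1" "z \<noteq> 0" using assms(2) by auto
  have "- (z * q) * z = - (z * z) * q" by (simp add: mult_ac)
  hence "q / z = - (z * q)" using zz by (simp add: divide_eq_eq)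
  moreover have "(z * q)\<^sup>2 = (z * z) * q\<^sup>2" by (simp add: power2_eq_square mult_ac)
  ultimately have "q / z = - (z * q)" "(z * q)\<^sup>2 = - (q\<^sup>2)" using zz(1) by simp_all
  hence 1: "qpoch (z * q) q * qpoch (q / z) q = qpoch (- (q\<^sup>2)) (q\<^sup>2)"
    using qpoch_mult_uminus[OF assms(1), of "z * q"] by simp
  have "qpoch q (q\<^sup>2) * qpoch (- q) (q\<^sup>2) = qpoch (q\<^sup>2) ((q\<^sup>2)\<^sup>2)"
    by (rule qpoch_mult_uminus[OF q2])
  with euler_odd_distinct[OF q2]
  have "qpoch q (q\<^sup>2) * qpoch (- q) (q\<^sup>2) * qpoch (- (q\<^sup>2)) (q\<^sup>2) = 1" by simp
  hence "qpoch q (q\<^sup>2) * qpoch (- q) (q\<^sup>2) = 1 / qpoch (- (q\<^sup>2)) (q\<^sup>2)"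
    by (metis mult_zero_right nonzero_eq_divide_eq zero_neq_one)
  thus ?thesis unfolding crank_prod_def 1 by simp
qed

text \<open>The three products in j(q^m;q^(3m)) collect the factors of (q^m;q^m) by residue modulo
  3.\<close>

lemma Jm_eq_qpoch:
  assumes "q \<noteq> 0" "norm q < 1" "m > 0"
  shows "Jm q m = qpoch (q ^ m) (q ^ m)"
proof -
  have qm: "norm (q ^ m) < 1" using assms by (intro norm_power_less_one)
  have "q ^ (3 * m) = (q ^ m) ^ 3" by (simp add: power_mult[symmetric] mult.commute)
  moreover have "(q ^ m) ^ 3 / q ^ m = q ^ m * q ^ m"
    using assms(1) by (simp add: power3_eq_cube)
  ultimately show ?thesis
    using qpoch_dissect3[OF qm, of "q ^ m"]
    by (simp add: Jm_def Jam_def jtheta_def power2_eq_square power3_eq_cube mult_ac)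
qed

context
  fixes q :: complex
  assumes q0: "q \<noteq> 0" and q1: "norm q < 1"
begin

lemma Jbar_8:
  shows "Jbar q 4 8 - q * Jbar q 0 8 = qpoch q q * qpoch q (q\<^sup>2)"
proof -
  have n2: "norm (q\<^sup>2) < 1" and n8: "q ^ 8 \<noteq> 0"
    using q0 q1 by (auto intro: norm_power_less_one)
  have "jtheta q (q\<^sup>2) = jtheta (- (q ^ 4)) (q ^ 8) - q * jtheta (- (q ^ 8)) (q ^ 8)"
    using jtheta_dissect2[of "q\<^sup>2" q] q0 n2 by (simp flip: power_mult power_add)
  \<comment> \<open>The dissection yields the argument -q^8, while \<open>Jbar q 0 8\<close> stands
    at -1; reflection exchanges the two.\<close>
  also have "jtheta (- (q ^ 8)) (q ^ 8) = jtheta (- 1) (q ^ 8)"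
    using jtheta_reflect[of "q ^ 8" "- (q ^ 8)"] n8 by simp
  finally have "Jbar q 4 8 - q * Jbar q 0 8 = jtheta q (q\<^sup>2)"
    by (simp add: Jbar_def)
  also have "\<dots> = qpoch q q * qpoch q (q\<^sup>2)"
    using qpoch_dissect2[OF q1, of q] q0
    by (simp add: jtheta_def power2_eq_square)
  finally show ?thesis .
qed

text \<open>Only s^2 = 1 enters the two halves of the dissection of j(sq;q^4), so s shows up just as
  the sign of the odd half. As q^4/(sq) = q^2 (sq), the first two products of j(sq;q^4) merge into
  (sq;q^2).\<close>

lemma Jbar_16:
  assumes "s = 1 \<or> s = -1"
  shows "Jbar q 6 16 - s * q * Jbar q 14 16 = qpoch (s * q) (q\<^sup>2) * Jm q 4"
proof -
  have n2: "norm (q\<^sup>2) < 1" and n4: "norm (q ^ 4) < 1" and s0: "s \<noteq> 0" and s2: "s * s = 1"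
    using q0 q1 assms by (auto intro: norm_power_less_one)
  have "jtheta (s * q) (q ^ 4) = jtheta (- (q ^ 6)) (q ^ 16) - s * q * jtheta (- (q ^ 14)) (q ^ 16)"
    using jtheta_dissect2[of "q ^ 4" "s * q"] q0 n4 s0 s2
    by (simp add: power_mult_distrib power2_eq_square[of s] flip: power_mult power_add)
  hence "Jbar q 6 16 - s * q * Jbar q 14 16 = jtheta (s * q) (q ^ 4)"
    by (simp add: Jbar_def)
  moreover have "q ^ 4 / (s * q) = q\<^sup>2 * (s * q)"
    using q0 s0 s2 by (simp add: field_simps power_numeral_reduce)
  moreover have "(q\<^sup>2)\<^sup>2 = q ^ 4" by (simp flip: power_mult)
  ultimately show ?thesis
    using qpoch_dissect2[OF n2, of "s * q"] Jm_eq_qpoch[OF q0 q1, of 4]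
    by (simp add: jtheta_def)
qed

lemma Jm_4_nonzero: "Jm q 4 \<noteq> 0"
  using q0 q1 by (simp add: Jm_eq_qpoch qpoch_nonzero norm_power_less_one)

text \<open>The four coefficients are those of c P A + 2 d P B after expansion in the theta
  products. The 2 is there because the roots \<i> and -\<i> share one crank product.\<close>

lemma vartheta4_eq:
  "vartheta4 q (c + 2 * d) (c - 2 * d) (2 * d - c) (- c - 2 * d) =
     (c * crank_prod (-1) q + 2 * d * crank_prod \<i> q) / 4"
proof -
  define P where "P = Jbar q 4 8 - q * Jbar q 0 8"
  define A where "A = Jbar q 6 16 - 1 * q * Jbar q 14 16"
  define B where "B = Jbar q 6 16 - (- 1) * q * Jbar q 14 16"
  have "(c + 2 * d) * Jbar q 4 8 * Jbar q 6 16 + (c - 2 * d) * q^2 * Jbar q 0 8 * Jbar q 14 16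
      + (2 * d - c) * q * Jbar q 4 8 * Jbar q 14 16 + (- c - 2 * d) * q * Jbar q 0 8 * Jbar q 6 16
      = c * (P * A) + 2 * d * (P * B)"
    unfolding P_def A_def B_def by (simp add: algebra_simps power2_eq_square)
  moreover have "P * A = crank_prod (-1) q * Jm q 4"
    unfolding P_def A_def Jbar_8 crank_prod_minus_one[OF q1]
    by (subst Jbar_16) (auto simp: power2_eq_square)
  moreover have "P * B = crank_prod \<i> q * Jm q 4"
    unfolding P_def B_def Jbar_8 by (subst Jbar_16) (auto simp: crank_prod_i[OF q1])
  ultimately have "vartheta4 q (c + 2 * d) (c - 2 * d) (2 * d - c) (- c - 2 * d) =
      (c * (crank_prod (-1) q * Jm q 4) + 2 * d * (crank_prod \<i> q * Jm q 4)) / (4 * Jm q 4)"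
    by (simp add: vartheta4_def)
  also have "\<dots> = (c * crank_prod (-1) q + 2 * d * crank_prod \<i> q) / 4"
    using Jm_4_nonzero by (simp add: field_simps)
  finally show ?thesis .
qed

end

section \<open>The crank generating function\<close>

text \<open>A multiset over \<open>insert x X\<close> is a multiplicity of x together with a
  multiset over X, so each new part multiplies the sum by a geometric series.\<close>

lemma has_sum_msets_finite:
  fixes w :: "nat \<Rightarrow> 'c :: {real_normed_field, banach}"
  assumes "finite X" "\<And>x. x \<in> X \<Longrightarrow> norm (w x) < 1"
  shows "(\<lambda>P. norm (\<Prod>x\<in>#P. w x)) summable_on {P. set_mset P \<subseteq> X} \<and>
         ((\<lambda>P. \<Prod>x\<in>#P. w x) has_sum (\<Prod>x\<in>X. 1 / (1 - w x))) {P. set_mset P \<subseteq> X}"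
  using assms
proof (induction X rule: finite_induct)
  case empty
  have "{P :: nat multiset. set_mset P \<subseteq> {}} = {{#}}" by auto
  thus ?case by (simp add: has_sum_finiteI)
next
  case (insert x X)
  have geo: "((\<lambda>n. w x ^ n) has_sum (1 / (1 - w x))) UNIV"
    and geo_abs: "(\<lambda>n. norm (w x ^ n)) summable_on UNIV"
  proof -
    have "summable (\<lambda>n. norm (w x ^ n))"
      using insert.prems by (simp add: norm_power summable_geometric)
    thus "((\<lambda>n. w x ^ n) has_sum (1 / (1 - w x))) UNIV" "(\<lambda>n. norm (w x ^ n)) summable_on UNIV"
      using insert.prems
      by (auto intro!: norm_summable_imp_has_sum norm_summable_imp_summable_on geometric_sums)
  qed
  have IH: "(\<lambda>P. norm (\<Prod>x\<in>#P. w x)) summable_on {P. set_mset P \<subseteq> X}"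
    "((\<lambda>P. \<Prod>x\<in>#P. w x) has_sum (\<Prod>x\<in>X. 1 / (1 - w x))) {P. set_mset P \<subseteq> X}"
    using insert.IH insert.prems by auto
  define i where "i = (\<lambda>M. (count M x, filter_mset (\<lambda>y. y \<noteq> x) M))"
  define j where "j = (\<lambda>(n, P). replicate_mset n x + P)"
  have ij: "i (j p) = p" "j p \<in> {P. set_mset P \<subseteq> insert x X}"
    "(\<Prod>y\<in>#j p. w y) = (case p of (n, P) \<Rightarrow> w x ^ n * (\<Prod>y\<in>#P. w y))"
    if pin: "p \<in> UNIV \<times> {P. set_mset P \<subseteq> X}" for p
  proof -
    obtain n P where p: "p = (n, P)" "set_mset P \<subseteq> X" using pin by (cases p) auto
    have xP: "x \<notin># P" using p(2) insert.hyps by auto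
    have "filter_mset (\<lambda>y. y \<noteq> x) P = P"
      using xP by (auto simp: multiset_eq_iff not_in_iff)
    thus "i (j p) = p" using xP by (simp add: p i_def j_def not_in_iff)
    show "j p \<in> {P. set_mset P \<subseteq> insert x X}" using p by (auto simp: j_def)
    show "(\<Prod>y\<in>#j p. w y) = (case p of (n, P) \<Rightarrow> w x ^ n * (\<Prod>y\<in>#P. w y))"
      by (simp add: p j_def)
  qed
  have ji: "j (i M) = M" "i M \<in> UNIV \<times> {P. set_mset P \<subseteq> X}"
    if "M \<in> {P. set_mset P \<subseteq> insert x X}" for M
    using that by (auto simp: i_def j_def multiset_eq_iff)
  have iW: "w x ^ fst (i M) * (\<Prod>y\<in>#snd (i M). w y) = (\<Prod>y\<in>#M. w y)"
    if "set_mset M \<subseteq> insert x X" for M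
    using ij(3)[OF ji(2), of M] ji(1)[of M] that by (simp add: case_prod_unfold)
  note prod = has_sum_mult_Times[OF geo_abs IH(1) geo IH(2)]
  have "(\<lambda>P. norm (\<Prod>x\<in>#P. w x)) summable_on {P. set_mset P \<subseteq> insert x X}"
    using prod(1) by (subst summable_on_reindex_bij_witness[where j = i and i = j
        and T = "UNIV \<times> {P. set_mset P \<subseteq> X}"
        and h = "\<lambda>(n, P). norm (w x ^ n * (\<Prod>y\<in>#P. w y))"])
       (use ij ji in \<open>auto simp: case_prod_unfold iW\<close>)
  moreover have "((\<lambda>P. \<Prod>x\<in>#P. w x) has_sum (1 / (1 - w x) * (\<Prod>x\<in>X. 1 / (1 - w x))))
      {P. set_mset P \<subseteq> insert x X}"
    using prod(2) by (subst has_sum_reindex_bij_witness[where j = i and i = j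
        and T = "UNIV \<times> {P. set_mset P \<subseteq> X}"
        and h = "\<lambda>(n, P). w x ^ n * (\<Prod>y\<in>#P. w y)"])
       (use ij ji in \<open>auto simp: case_prod_unfold iW\<close>)
  ultimately show ?case using insert.hyps by simp
qed

lemma prodinf_inverse_LIMSEQ:
  fixes w :: "nat \<Rightarrow> 'c :: {real_normed_field, banach}"
  assumes "summable (\<lambda>n. norm (w n))" "\<And>n. norm (w n) < 1"
  shows "(\<lambda>N. \<Prod>n<N. 1 / (1 - w n)) \<longlonglongrightarrow> 1 / (\<Prod>n. 1 - w n)"
proof -
  have "convergent_prod (\<lambda>n. 1 - w n)"
    using assms(1)
    by (intro abs_convergent_prod_imp_convergent_prod summable_imp_abs_convergent_prod) simp
  moreover have "1 - w n \<noteq> 0" for n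
    using assms(2)[of n] by auto
  ultimately have "(\<lambda>N. \<Prod>n<N. 1 - w n) \<longlonglongrightarrow> (\<Prod>n. 1 - w n)" "(\<Prod>n. 1 - w n) \<noteq> 0"
    by (auto intro!: has_prod_imp_tendsto' convergent_prod_has_prod simp: prodinf_nonzero)
  from tendsto_divide[OF tendsto_const this, of 1] show ?thesis
    by (simp add: prod_dividef)
qed

text \<open>
  Parts that are not allowed have weight zero, so the sum may run over all multisets.
\<close>

theorem has_sum_msets:
  fixes w :: "nat \<Rightarrow> 'c :: {real_normed_field, banach}"
  assumes sm: "summable (\<lambda>n. norm (w n))" and w1: "\<And>n. norm (w n) < 1"
  shows "(\<lambda>P. norm (\<Prod>x\<in>#P. w x)) summable_on UNIV"
    and "((\<lambda>P. \<Prod>x\<in>#P. w x) has_sum (1 / (\<Prod>n. 1 - w n))) UNIV"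
proof -
  define A where "A N = {P. set_mset P \<subseteq> {..<N :: nat}}" for N
  define W where "W = (\<lambda>P. \<Prod>x\<in>#P. w x)"
  have fin: "\<exists>N0. \<forall>N\<ge>N0. F \<subseteq> A N" if "finite F" for F
  proof -
    have "finite (\<Union>P\<in>F. set_mset P)" using that by auto
    then obtain N0 where "(\<Union>P\<in>F. set_mset P) \<subseteq> {..<N0}"
      using finite_nat_iff_bounded by auto
    thus ?thesis by (intro exI[of _ N0]) (force simp: A_def)
  qed
  have WA: "(W has_sum (\<Prod>x<N. 1 / (1 - w x))) (A N)" for N
    unfolding A_def W_def using has_sum_msets_finite[of "{..<N}" w] w1 by auto
  have "(\<lambda>N. \<Prod>n<N. 1 / (1 - norm (w n))) \<longlonglongrightarrow> 1 / (\<Prod>n. 1 - norm (w n))"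
    using prodinf_inverse_LIMSEQ[of "\<lambda>n. norm (w n)"] sm w1 by simp
  \<comment> \<open>The product formula for the weights \<open>norm (w n)\<close> has convergent,
    hence bounded, right-hand sides; \<open>K\<close> then bounds every finite sum of norms.\<close>
  hence "bounded (range (\<lambda>N. \<Prod>n<N. 1 / (1 - norm (w n))))"
    by (intro convergent_imp_bounded)
  then obtain K where "\<And>N. norm (\<Prod>n<N. 1 / (1 - norm (w n))) \<le> K"
    by (auto simp: bounded_iff)
  hence K: "(\<Prod>n<N. 1 / (1 - norm (w n))) \<le> K" for N
    by (metis abs_le_D1 real_norm_def)
  show abs: "(\<lambda>P. norm (\<Prod>x\<in>#P. w x)) summable_on UNIV"
  proof (rule nonneg_bdd_above_summable_on)
    show "bdd_above (sum (\<lambda>P. norm (\<Prod>x\<in>#P. w x)) ` {F. F \<subseteq> UNIV \<and> finite F})"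
    proof (rule bdd_aboveI2)
      fix F :: "nat multiset set" assume "F \<in> {F. F \<subseteq> UNIV \<and> finite F}"
      hence F: "finite F" by simp
      then obtain N where "F \<subseteq> A N" using fin by blast
      moreover have "((\<lambda>P. \<Prod>x\<in>#P. norm (w x)) has_sum (\<Prod>x<N. 1 / (1 - norm (w x)))) (A N)"
        unfolding A_def using has_sum_msets_finite[of "{..<N}" "\<lambda>x. norm (w x)"] w1 by auto
      moreover have "norm (\<Prod>x\<in>#P. w x) = (\<Prod>x\<in>#P. norm (w x))" for P
        by (induction P) (auto simp: norm_mult)
      ultimately have "(\<Sum>P\<in>F. norm (\<Prod>x\<in>#P. w x)) \<le> (\<Prod>x<N. 1 / (1 - norm (w x)))"
        using F by (metis (mono_tags, lifting) finite_sum_le_has_sum norm_ge_zero sum.cong)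
      also have "\<dots> \<le> K" by (rule K)
      finally show "(\<Sum>P\<in>F. norm (\<Prod>x\<in>#P. w x)) \<le> K" .
    qed
  qed auto
  have "W summable_on UNIV"
    unfolding W_def by (rule abs_summable_summable[OF abs])
  then obtain S where S: "(W has_sum S) UNIV"
    by (auto simp: summable_on_def)
  have "(\<lambda>N. \<Prod>n<N. 1 / (1 - w n)) \<longlonglongrightarrow> S"
  proof (rule metric_LIMSEQ_I)
    fix e :: real assume "e > 0"
    hence "\<forall>\<^sub>F F in finite_subsets_at_top UNIV. dist (sum W F) S < e / 2"
      using S unfolding has_sum_def by (intro tendstoD) auto
    then obtain F0 where F0: "finite F0" "\<And>F. finite F \<Longrightarrow> F0 \<subseteq> F \<Longrightarrow> dist (sum W F) S < e / 2"
      unfolding eventually_finite_subsets_at_top by auto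
    obtain N0 where N0: "\<And>N. N \<ge> N0 \<Longrightarrow> F0 \<subseteq> A N" using fin[OF F0(1)] by blast
    \<comment> \<open>The sum over \<open>A N\<close> is a limit of finite sums containing
      \<open>F0\<close>, each within e/2 of \<open>S\<close>. The limit only keeps a weak
      inequality, hence e/2 instead of e.\<close>
    have "dist (\<Prod>n<N. 1 / (1 - w n)) S \<le> e / 2" if "N \<ge> N0" for N
    proof (rule tendsto_upperbound)
      show "((\<lambda>F. dist (sum W F) S) \<longlongrightarrow> dist (\<Prod>n<N. 1 / (1 - w n)) S) (finite_subsets_at_top (A N))"
        using WA[of N] unfolding has_sum_def by (intro tendsto_intros)
      show "\<forall>\<^sub>F F in finite_subsets_at_top (A N). dist (sum W F) S \<le> e / 2"
        unfolding eventually_finite_subsets_at_top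
        using F0 N0[OF that] by (intro exI[of _ F0]) (auto intro: less_imp_le)
    qed auto
    thus "\<exists>no. \<forall>n\<ge>no. dist (\<Prod>n<n. 1 / (1 - w n)) S < e"
      using \<open>e > 0\<close> by (intro exI[of _ N0]) fastforce
  qed
  from LIMSEQ_unique[OF this prodinf_inverse_LIMSEQ[OF sm w1]]
  show "((\<lambda>P. \<Prod>x\<in>#P. w x) has_sum (1 / (\<Prod>n. 1 - w n))) UNIV"
    using S unfolding W_def by simp
qed

section \<open>Partition sums weighted by the crank\<close>

text \<open>One weight for both clauses of the crank. With y = z and j the number of ones, z marks
  the parts counted by the crank; with y = 0, parts above j are forbidden and j is the largest part.
  Ones are put back separately.\<close>

definition part_weight :: "complex \<Rightarrow> complex \<Rightarrow> nat \<Rightarrow> nat \<Rightarrow> complex" where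
  "part_weight q y j s = (if s < 2 then 0 else if j < s then y * q ^ s else q ^ s)"

lemma prod_part_weight:
  "(\<Prod>s\<in>#R. part_weight q y j s) =
     (if 0 \<in># R \<or> 1 \<in># R then 0
      else y ^ size (filter_mset (\<lambda>s. s > j) R) * q ^ sum_mset R)"
proof (induction R)
  case (add s R)
  have "s < 2 \<longleftrightarrow> s = 0 \<or> s = 1" by auto
  thus ?case using add.IH by (auto simp: part_weight_def power_add)
qed simp

lemma norm_part_weight:
  assumes "norm q < 1" "norm y \<le> 1"
  shows "norm (part_weight q y j s) \<le> norm q ^ s" "norm (part_weight q y j s) < 1"
proof -
  show le: "norm (part_weight q y j s) \<le> norm q ^ s"
    using assms(2) by (auto simp: part_weight_def norm_mult norm_power mult_left_le_one_le)
  show "norm (part_weight q y j s) < 1"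
  proof (cases "s < 2")
    case False
    hence "norm q ^ s < 1" using assms by (simp add: power_less_one_iff)
    thus ?thesis using le by simp
  qed (simp add: part_weight_def)
qed

lemma summable_part_weight:
  assumes "norm q < 1" "norm y \<le> 1"
  shows "summable (\<lambda>s. norm (part_weight q y j s))"
  by (rule summable_comparison_test'[of "\<lambda>s. norm q ^ s" 0])
     (use assms norm_part_weight(1)[OF assms] in \<open>auto intro: summable_geometric\<close>)

text \<open>The factor \<open>1 - q\<close> stands in for the excluded part 1 and completes the
  parts 2 to j to the full finite product.\<close>

lemma prodinf_part_weight:
  assumes "norm q < 1" "norm y \<le> 1" "j > 0"
  shows "(1 - q) * (\<Prod>s. 1 - part_weight q y j s) =
           (\<Prod>i<j. 1 - q ^ Suc i) * qpoch (y * q ^ Suc j) q"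
proof -
  let ?w = "part_weight q y j"
  have "convergent_prod (\<lambda>s. 1 - ?w s)"
    using summable_part_weight[OF assms(1,2)]
    by (intro abs_convergent_prod_imp_convergent_prod summable_imp_abs_convergent_prod) simp
  moreover have "1 - ?w s \<noteq> 0" for s
    using norm_part_weight(2)[OF assms(1,2), of j s] by auto
  ultimately have "(\<Prod>s. 1 - ?w s) = (\<Prod>s. 1 - ?w (s + Suc j)) * (\<Prod>s<Suc j. 1 - ?w s)"
    by (intro prodinf_split_initial_segment)
  also have "(\<Prod>s. 1 - ?w (s + Suc j)) = qpoch (y * q ^ Suc j) q"
    using assms(3) unfolding qpoch_def part_weight_def
    by (intro prodinf_cong) (auto simp: power_add)
  finally have 1: "(\<Prod>s. 1 - ?w s) = qpoch (y * q ^ Suc j) q * (\<Prod>s<Suc j. 1 - ?w s)" .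
  have "(1 - q) * (\<Prod>s<Suc n. 1 - ?w s) = (\<Prod>i<n. 1 - q ^ Suc i)" if "n > 0" "n \<le> j" for n
    using that
  proof (induction n)
    case (Suc n)
    show ?case
    proof (cases "n = 0")
      case True
      thus ?thesis by (simp add: part_weight_def)
    next
      case False
      hence "1 - ?w (Suc n) = 1 - q ^ Suc n" using Suc.prems by (simp add: part_weight_def)
      thus ?thesis using Suc.IH False Suc.prems
        by (simp add: mult.assoc[symmetric])
    qed
  qed simp
  from this[of j] 1 assms(3) show ?thesis by (simp add: mult_ac)
qed

lemma crank_replicate_ones:
  assumes "1 \<notin># R" "j > 0"
  shows "crank (replicate_mset j 1 + R) = int (size (filter_mset (\<lambda>s. s > j) R)) - int j"
proof -
  have c: "count (replicate_mset j 1 + R) 1 = j" using assms by (simp add: not_in_iff)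
  have "filter_mset (\<lambda>s. s > j) (replicate_mset j 1) = {#}" using assms(2) by auto
  thus ?thesis using assms(2) unfolding crank_def c by simp
qed

context
  fixes z q :: complex
  assumes z: "norm z = 1" and q0: "q \<noteq> 0" and q1: "norm q < 1"
begin

lemma z_nonzero: "z \<noteq> 0" using z by auto

text \<open>The j ones add j to the size and -j to the crank, hence (q/z)^j; what remains is any
  multiset of parts at least 2.\<close>

lemma has_sum_crank_ones:
  assumes "j > 0"
  shows "((\<lambda>P. z powi crank P * q ^ sum_mset P) has_sum
            (q / z) ^ j / (\<Prod>s. 1 - part_weight q z j s)) {P. 0 \<notin># P \<and> P \<noteq> {#} \<and> count P 1 = j}"
proof -
  let ?w = "part_weight q z j"
  have "((\<lambda>R. \<Prod>s\<in>#R. ?w s) has_sum 1 / (\<Prod>s. 1 - ?w s)) UNIV"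
    using z q1 by (intro has_sum_msets summable_part_weight norm_part_weight) auto
  hence "((\<lambda>R. \<Prod>s\<in>#R. ?w s) has_sum 1 / (\<Prod>s. 1 - ?w s)) {R. 0 \<notin># R \<and> 1 \<notin># R}"
    by (rule has_sum_cong_neutral[THEN iffD1, rotated -1]) (auto simp: prod_part_weight)
  hence "((\<lambda>R. (q / z) ^ j * (\<Prod>s\<in>#R. ?w s)) has_sum (q / z) ^ j * (1 / (\<Prod>s. 1 - ?w s)))
      {R. 0 \<notin># R \<and> 1 \<notin># R}"
    by (rule has_sum_cmult_right)
  also have "?this \<longleftrightarrow> ?thesis"
  proof (rule has_sum_reindex_bij_witness[where j = "\<lambda>R. replicate_mset j 1 + R"
        and i = "filter_mset (\<lambda>x. x \<noteq> 1)"])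
    fix R :: "nat multiset" assume R: "R \<in> {R. 0 \<notin># R \<and> 1 \<notin># R}"
    have "filter_mset (\<lambda>x. x \<noteq> 1) R = R"
      using R by (auto simp: multiset_eq_iff not_in_iff)
    thus "filter_mset (\<lambda>x. x \<noteq> 1) (replicate_mset j 1 + R) = R" by simp
    show "replicate_mset j 1 + R \<in> {P. 0 \<notin># P \<and> P \<noteq> {#} \<and> count P 1 = j}"
      using R assms by (auto simp: not_in_iff)
    show "z powi crank (replicate_mset j 1 + R) * q ^ sum_mset (replicate_mset j 1 + R) =
          (q / z) ^ j * (\<Prod>s\<in>#R. ?w s)"
      using R assms z_nonzero crank_replicate_ones[of R j]
      by (simp add: prod_part_weight power_int_diff power_add power_divide
          sum_mset_replicate_mset)
  next
    fix P :: "nat multiset" assume P: "P \<in> {P. 0 \<notin># P \<and> P \<noteq> {#} \<and> count P 1 = j}"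
    thus "replicate_mset j 1 + filter_mset (\<lambda>x. x \<noteq> 1) P = P"
      by (auto simp: multiset_eq_iff)
    show "filter_mset (\<lambda>x. x \<noteq> 1) P \<in> {R. 0 \<notin># R \<and> 1 \<notin># R}"
      using P by auto
  qed simp
  finally show ?thesis .
qed

text \<open>One copy of the largest part k is removed; it carries the whole crank and gives (zq)^k,
  leaving any multiset of parts from 2 to k.\<close>

lemma has_sum_crank_no_ones:
  assumes "k \<ge> 2"
  shows "((\<lambda>P. z powi crank P * q ^ sum_mset P) has_sum
            (z * q) ^ k / (\<Prod>s. 1 - part_weight q 0 k s))
            {P. 0 \<notin># P \<and> P \<noteq> {#} \<and> count P 1 = 0 \<and> Max (set_mset P) = k}"
proof -
  let ?w = "part_weight q 0 k"
  let ?A = "{R. 0 \<notin># R \<and> 1 \<notin># R \<and> (\<forall>x\<in>#R. x \<le> k)}"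
  have w: "(\<Prod>s\<in>#R. ?w s) = (if R \<in> ?A then q ^ sum_mset R else 0)" for R
  proof -
    \<comment> \<open>Because \<open>0 ^ 0 = 1\<close>, the weight with y = 0 survives exactly if no
      part exceeds k.\<close>
    have "filter_mset (\<lambda>s. s > k) R = {#} \<longleftrightarrow> (\<forall>x\<in>#R. x \<le> k)"
      by (auto simp: filter_mset_eq_conv not_less)
    thus ?thesis by (auto simp: prod_part_weight power_0_left)
  qed
  have "((\<lambda>R. \<Prod>s\<in>#R. ?w s) has_sum 1 / (\<Prod>s. 1 - ?w s)) UNIV"
    using q1 by (intro has_sum_msets summable_part_weight norm_part_weight) auto
  hence "((\<lambda>R. \<Prod>s\<in>#R. ?w s) has_sum 1 / (\<Prod>s. 1 - ?w s)) ?A"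
    by (rule has_sum_cong_neutral[THEN iffD1, rotated -1]) (auto simp: w)
  hence "((\<lambda>R. (z * q) ^ k * (\<Prod>s\<in>#R. ?w s)) has_sum (z * q) ^ k * (1 / (\<Prod>s. 1 - ?w s))) ?A"
    by (rule has_sum_cmult_right)
  also have "?this \<longleftrightarrow> ?thesis"
  proof (rule has_sum_reindex_bij_witness[where j = "add_mset k" and i = "\<lambda>P. P - {#k#}"])
    fix R :: "nat multiset" assume R: "R \<in> ?A"
    show "add_mset k R - {#k#} = R" by simp
    have M: "Max (set_mset (add_mset k R)) = k"
      using R by (intro Max_eqI) auto
    have c: "count (add_mset k R) 1 = 0"
      using R assms by (auto simp: not_in_iff)
    show "add_mset k R \<in> {P. 0 \<notin># P \<and> P \<noteq> {#} \<and> count P 1 = 0 \<and> Max (set_mset P) = k}"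
      using R M c assms by auto
    have "crank (add_mset k R) = int k" unfolding crank_def c M by simp
    thus "z powi crank (add_mset k R) * q ^ sum_mset (add_mset k R) =
          (z * q) ^ k * (\<Prod>s\<in>#R. ?w s)"
      using R by (simp add: w power_add power_mult_distrib)
  next
    fix P :: "nat multiset"
    assume P: "P \<in> {P. 0 \<notin># P \<and> P \<noteq> {#} \<and> count P 1 = 0 \<and> Max (set_mset P) = k}"
    hence k: "k \<in># P" "\<forall>x\<in>#P. x \<le> k" by (auto simp: Max_eq_iff)
    thus "add_mset k (P - {#k#}) = P" by simp
    show "P - {#k#} \<in> ?A"
      using P k by (auto dest: in_diffD simp: count_eq_zero_iff)
  qed simp
  finally show ?thesis .
qed

text \<open>As \<open>norm z = 1\<close>, the norms are those of the plain partition series, in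
  which the part 1 is allowed.\<close>

lemma summable_crank:
  "(\<lambda>P. z powi crank P * q ^ sum_mset P) summable_on {P. 0 \<notin># P \<and> P \<noteq> {#}}"
proof (rule abs_summable_summable)
  define w where "w s = (if s = 0 then 0 else q ^ s)" for s
  have w: "norm (w s) \<le> norm q ^ s" "norm (w s) < 1" for s
    using q1 by (auto simp: w_def norm_power power_less_one_iff)
  have "summable (\<lambda>s. norm (w s))"
    by (rule summable_comparison_test'[of "\<lambda>s. norm q ^ s" 0])
       (use q1 w(1) in \<open>auto intro: summable_geometric\<close>)
  hence "(\<lambda>P. norm (\<Prod>s\<in>#P. w s)) summable_on UNIV"
    using w(2) by (intro has_sum_msets(1)) auto
  hence "(\<lambda>P. norm (\<Prod>s\<in>#P. w s)) summable_on {P. 0 \<notin># P \<and> P \<noteq> {#}}"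
    by (rule summable_on_subset_banach) auto
  also have "?this \<longleftrightarrow> (\<lambda>P. norm (z powi crank P * q ^ sum_mset P)) summable_on {P. 0 \<notin># P \<and> P \<noteq> {#}}"
  proof (rule summable_on_cong)
    fix P :: "nat multiset" assume "P \<in> {P. 0 \<notin># P \<and> P \<noteq> {#}}"
    hence "0 \<notin># P" by simp
    hence "(\<Prod>s\<in>#P. w s) = q ^ sum_mset P"
      by (induction P) (auto simp: w_def power_add)
    thus "norm (\<Prod>s\<in>#P. w s) = norm (z powi crank P * q ^ sum_mset P)"
      using z by (simp add: norm_mult norm_power_int)
  qed
  finally show "(\<lambda>P. norm (z powi crank P * q ^ sum_mset P)) summable_on {P. 0 \<notin># P \<and> P \<noteq> {#}}" .
qed

text \<open>
  Partitions are grouped by their number of ones, and those without ones by their largest part.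
  Both sums are instances of the \<open>q\<close>-binomial theorem. The value differs from the crank product by
  the empty partition and by the anomalous coefficient of \<open>q\<close>.
\<close>

lemma has_sum_crank:
  "((\<lambda>P. z powi crank P * q ^ sum_mset P) has_sum (crank_prod z q - 1 - (z - 1) * q))
     {P. 0 \<notin># P \<and> P \<noteq> {#}}"
proof -
  define f where "f = (\<lambda>P. z powi crank P * q ^ sum_mset P)"
  define PP where "PP = {P :: nat multiset. 0 \<notin># P \<and> P \<noteq> {#}}"
  define C where "C = (1 - q) / qpoch (z * q) q"
  have qz: "norm (q / z) < 1" "norm (z * q) < 1"
    using q1 z by (auto simp: norm_divide norm_mult)
  have nz: "1 - q \<noteq> 0" "qpoch (z * q) q \<noteq> 0" "qpoch (q / z) q \<noteq> 0"
    using q1 qz qpoch_nonzero by auto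
  have powz: "(\<Prod>i<n. 1 - q ^ Suc i) \<noteq> 0" for n
    using one_minus_power_nonzero[OF q1] by simp
  \<comment> \<open>Both sequences are defined at all indices so that the q-binomial theorem sums
    them. They describe partitions only for j > 0 and k \<ge> 2; the surplus terms are taken off
    below.\<close>
  define b where "b j = C * (qbinom_coeff 1 (z * q) q j * (q / z) ^ j)" for j
  define c where "c k = (1 - q) * (qbinom_coeff 1 0 q k * (z * q) ^ k)" for k
  have b_sum: "(b has_sum crank_prod z q) UNIV"
  proof -
    \<comment> \<open>The numerator of the q-binomial sum is (q^2;q), which the factor
      \<open>1 - q\<close> of \<open>C\<close> completes to (q;q).\<close>
    have "z * q * (q / z) = q ^ 1 * q" using z_nonzero by simp
    hence "C * (qpoch (z * q * (q / z)) q / qpoch (1 * (q / z)) q) = crank_prod z q"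
      using qpoch_split[OF q1, of q 1] nz by (simp add: C_def crank_prod_def)
    thus ?thesis
      using has_sum_cmult_right[OF qbinomial_theorem[OF q1, of 1 "q / z" "z * q"], of C] qz
      by (simp add: b_def[abs_def])
  qed
  have c_sum: "(c has_sum C) UNIV"
    using has_sum_cmult_right[OF qbinomial_theorem[OF q1, of 1 "z * q" 0], of "1 - q"] qz
    by (simp add: c_def[abs_def] C_def)
  have fb: "(f has_sum b j) {P \<in> PP. count P 1 = j}" if j: "j > 0" for j
  proof -
    \<comment> \<open>Taking the j-independent (zq;q) as common denominator moves its first j
      factors into the numerator, where they form the q-binomial coefficient.\<close>
    have "qpoch (z * q) q = (\<Prod>i<j. 1 - q ^ i * (z * q)) * qpoch (q ^ j * (z * q)) q"
      by (rule qpoch_split[OF q1])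
    moreover have "q ^ j * (z * q) = z * q ^ Suc j" by simp
    ultimately have 1: "qpoch (z * q) q = (\<Prod>i<j. 1 - q ^ i * (z * q)) * qpoch (z * q ^ Suc j) q"
      by simp
    have 2: "(1 - q) * (\<Prod>s. 1 - part_weight q z j s) =
           (\<Prod>i<j. 1 - q ^ Suc i) * qpoch (z * q ^ Suc j) q"
      using z j by (intro prodinf_part_weight q1) auto
    have 3: "qbinom_coeff 1 (z * q) q j = (\<Prod>i<j. 1 - q ^ i * (z * q)) / (\<Prod>i<j. 1 - q ^ Suc i)"
      by (simp add: qbinom_coeff_def prod_dividef mult_ac)
    have D: "(\<Prod>s. 1 - part_weight q z j s) =
           (\<Prod>i<j. 1 - q ^ Suc i) * qpoch (z * q ^ Suc j) q / (1 - q)"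
      using 2 nz by (simp add: field_simps)
    have "(q / z) ^ j / (\<Prod>s. 1 - part_weight q z j s) = b j"
      using nz(1,2) powz[of j] unfolding b_def C_def D 3 1 by (simp add: mult_ac)
    thus ?thesis using has_sum_crank_ones[OF j] by (simp add: f_def PP_def conj_assoc)
  qed
  have fc: "(f has_sum c k) {P \<in> {P \<in> PP. count P 1 = 0}. Max (set_mset P) = k}" if k: "k \<ge> 2" for k
  proof -
    have 2: "(1 - q) * (\<Prod>s. 1 - part_weight q 0 k s) = (\<Prod>i<k. 1 - q ^ Suc i)"
      using k prodinf_part_weight[OF q1, of 0 k] by simp
    have 3: "qbinom_coeff 1 0 q k = 1 / (\<Prod>i<k. 1 - q ^ Suc i)"
      by (simp add: qbinom_coeff_def prod_dividef)
    have D: "(\<Prod>s. 1 - part_weight q 0 k s) = (\<Prod>i<k. 1 - q ^ Suc i) / (1 - q)"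
      using 2 nz by (simp add: field_simps)
    have "(z * q) ^ k / (\<Prod>s. 1 - part_weight q 0 k s) = c k"
      unfolding c_def D 3 by simp
    thus ?thesis using has_sum_crank_no_ones[OF k] by (simp add: f_def PP_def conj_assoc)
  qed
  have f_summable: "f summable_on PP" using summable_crank by (simp add: f_def PP_def)
  have "f summable_on {P \<in> PP. count P 1 = 0}"
    by (rule summable_on_subset_banach[OF f_summable]) auto
  then obtain g0 where g0: "(f has_sum g0) {P \<in> PP. count P 1 = 0}" by (auto simp: summable_on_def)
  obtain S where S: "(f has_sum S) PP" using f_summable by (auto simp: summable_on_def)
  have "((\<lambda>k. if k < 2 then 0 else c k) has_sum g0) UNIV"
  proof (rule has_sum_fibers[OF g0])
    fix k
    show "(f has_sum (if k < 2 then 0 else c k)) {P \<in> {P \<in> PP. count P 1 = 0}. Max (set_mset P) = k}"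
    proof (cases "k < 2")
      case True
      have "P \<notin> {P \<in> {P \<in> PP. count P 1 = 0}. Max (set_mset P) = k}" for P
      proof
        assume P: "P \<in> {P \<in> {P \<in> PP. count P 1 = 0}. Max (set_mset P) = k}"
        hence "k \<in># P" using Max_in[of "set_mset P"] by (auto simp: PP_def)
        moreover have "0 \<notin># P" "1 \<notin># P" using P unfolding PP_def not_in_iff by auto
        ultimately have "k \<noteq> 0" "k \<noteq> 1" by metis+
        thus False using True by simp
      qed
      hence "{P \<in> {P \<in> PP. count P 1 = 0}. Max (set_mset P) = k} = {}" by blast
      thus ?thesis using True by (simp only: if_True has_sum_empty)
    qed (use fc in simp)
  qed
  moreover have "((\<lambda>k. c k + (if k < 2 then - c k else 0)) has_sum (C + (- c 0 - c 1))) UNIV"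
    by (intro has_sum_add c_sum has_sum_finite_neutralI[of "{0, 1}"]) auto
  moreover have "(\<lambda>k. c k + (if k < 2 then - c k else 0)) = (\<lambda>k. if k < 2 then 0 else c k)" by auto
  ultimately have g0_eq: "g0 = C - c 0 - c 1" by (auto dest: has_sum_unique)
  have "((\<lambda>j. if j = 0 then g0 else b j) has_sum S) UNIV"
    by (rule has_sum_fibers[OF S]) (use g0 fb in auto)
  moreover have "((\<lambda>j. b j + (if j = 0 then g0 - b 0 else 0)) has_sum (crank_prod z q + (g0 - b 0))) UNIV"
    by (intro has_sum_add b_sum has_sum_finite_neutralI[of "{0}"]) auto
  moreover have "(\<lambda>j. b j + (if j = 0 then g0 - b 0 else 0)) = (\<lambda>j. if j = 0 then g0 else b j)" by auto
  ultimately have "S = crank_prod z q + (g0 - b 0)" by (auto dest: has_sum_unique)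
  \<comment> \<open>The surplus \<open>b 0\<close> equals the full sum \<open>C\<close> of
    \<open>c\<close>, so both cancel and only -\<open>c 0\<close> - \<open>c 1\<close>
    remains.\<close>
  moreover have "b 0 = C" "c 0 = 1 - q" "c 1 = z * q"
    using nz(1) by (auto simp: b_def c_def qbinom_coeff_def)
  ultimately have "S = crank_prod z q - 1 - (z - 1) * q"
    unfolding g0_eq by (simp add: algebra_simps)
  thus ?thesis using S by (simp add: f_def PP_def)
qed

end

section \<open>From sums over partitions to coefficients of q^n\<close>

lemma finite_partitions: "finite (partitions n)"
proof -
  have "P \<in> multisets_of_size {..n} (size P)" and "size P \<le> n" if P: "P \<in> partitions n" for P
  proof -
    have "x \<le> n" if "x \<in># P" for x
      using P multi_member_split[OF that] by (auto simp: partitions_def)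
    thus "P \<in> multisets_of_size {..n} (size P)" by (auto simp: multisets_of_size_def)
    have "size P \<le> sum_mset P" if "\<forall>x\<in>#P. x > 0" for P :: "nat multiset"
      using that by (induction P) auto
    thus "size P \<le> n" using P by (auto simp: partitions_def)
  qed
  hence "partitions n \<subseteq> (\<Union>k\<le>n. multisets_of_size {..n} k)" by blast
  thus ?thesis by (rule finite_subset) auto
qed

lemma partitions_0: "partitions 0 = {{#}}"
proof -
  have "P = {#}" if "\<forall>x\<in>#P. x > 0" "sum_mset P = 0" for P :: "nat multiset"
    using that by (cases P) auto
  thus ?thesis by (auto simp: partitions_def)
qed

lemma partitions_1: "partitions (Suc 0) = {{#Suc 0#}}"
proof -
  have "P = {#Suc 0#}" if P: "\<forall>x\<in>#P. x > 0" "sum_mset P = Suc 0" for P :: "nat multiset"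
  proof -
    obtain x R where xR: "P = add_mset x R" using P(2) by (cases P) auto
    hence "x + sum_mset R = Suc 0" "x > 0" using P by auto
    hence "x = Suc 0" "sum_mset R = 0" by linarith+
    thus ?thesis using xR P(1) by (cases R) auto
  qed
  thus ?thesis by (auto simp: partitions_def)
qed

definition crank_poly :: "complex \<Rightarrow> nat \<Rightarrow> complex" where
  "crank_poly z n = (\<Sum>\<^sub>\<infinity>m. of_int (Ccrank m n) * z powi m)"

text \<open>Below n = 2 the cranks of partitions would not do: at n = 1 the only partition has crank
  -1, but \<open>Ccrank\<close> is also nonzero at 0 and 1.\<close>

definition crank_support :: "nat \<Rightarrow> int set" where
  "crank_support n = (if n < 2 then {-1, 0, 1} else crank ` partitions n)"

lemma finite_crank_support: "finite (crank_support n)"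
  by (simp add: crank_support_def finite_partitions)

lemma Ccrank_outside_support:
  assumes "m \<notin> crank_support n"
  shows "Ccrank m n = 0"
proof (cases "n < 2")
  case True
  hence "n = 0 \<or> n = 1" by auto
  thus ?thesis using assms by (auto simp: crank_support_def Ccrank_def)
next
  case False
  hence "{P \<in> partitions n. crank P = m} = {}" using assms by (auto simp: crank_support_def)
  hence "card {P \<in> partitions n. crank P = m} = 0" by (simp only: card.empty)
  thus ?thesis using False by (auto simp: Ccrank_def)
qed

lemma infsum_Ccrank:
  "(\<Sum>\<^sub>\<infinity>m. of_int (Ccrank m n) * g m) = (\<Sum>m\<in>crank_support n. of_int (Ccrank m n) * (g m :: complex))"
proof -
  have "(\<Sum>\<^sub>\<infinity>m. of_int (Ccrank m n) * g m) = (\<Sum>\<^sub>\<infinity>m\<in>crank_support n. of_int (Ccrank m n) * g m)"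
    by (intro infsum_cong_neutral) (auto simp: Ccrank_outside_support)
  thus ?thesis by (simp add: finite_crank_support)
qed

text \<open>The empty partition has no meaningful crank and is replaced by its coefficient 1. At n =
  1 the partition gives 1/z, whereas the coefficient is z + 1/z - 1.\<close>

lemma crank_poly_eq:
  "crank_poly z n = (\<Sum>P\<in>partitions n - {{#}}. z powi crank P) +
     (if n = 0 then 1 else if n = 1 then z - 1 else 0)"
proof -
  consider "n = 0" | "n = 1" | "n \<ge> 2" by linarith
  thus ?thesis
  proof cases
    case 1
    thus ?thesis unfolding crank_poly_def infsum_Ccrank
      by (simp add: crank_support_def Ccrank_def partitions_0)
  next
    case 2
    have "crank {#Suc 0#} = - 1" by (simp add: crank_def)
    thus ?thesis using 2 unfolding crank_poly_def infsum_Ccrank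
      by (simp add: crank_support_def Ccrank_def partitions_1 power_int_minus)
  next
    case 3
    hence "partitions n - {{#}} = partitions n" by (auto simp: partitions_def)
    moreover have "(\<Sum>P\<in>partitions n. z powi crank P) =
        (\<Sum>m\<in>crank ` partitions n. \<Sum>P\<in>{P \<in> partitions n. crank P = m}. z powi crank P)"
      by (rule sum.image_gen[OF finite_partitions])
    moreover have "\<dots> = (\<Sum>m\<in>crank ` partitions n. of_int (Ccrank m n) * z powi m)"
      using 3 by (intro sum.cong) (auto simp: Ccrank_def)
    ultimately show ?thesis using 3
      by (simp add: crank_poly_def infsum_Ccrank crank_support_def)
  qed
qed

text \<open>Sorting the crank sum by size leaves the terms 1 and (z - 1) q missing, and these are
  exactly the corrections in \<open>crank_poly\<close>.\<close>

lemma crank_poly_sums: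
  assumes "norm z = 1" "q \<noteq> 0" "norm q < 1"
  shows "(\<lambda>n. crank_poly z n * q ^ n) sums crank_prod z q"
proof -
  have "((\<lambda>n. (\<Sum>P\<in>partitions n - {{#}}. z powi crank P) * q ^ n) has_sum
           (crank_prod z q - 1 - (z - 1) * q)) UNIV"
  proof (rule has_sum_fibers[OF has_sum_crank[OF assms]])
    fix n
    have "{P \<in> {P. 0 \<notin># P \<and> P \<noteq> {#}}. sum_mset P = n} = partitions n - {{#}}"
      by (auto simp: partitions_def) (metis not_gr_zero)
    moreover have "(\<Sum>P\<in>partitions n - {{#}}. z powi crank P * q ^ sum_mset P) =
        (\<Sum>P\<in>partitions n - {{#}}. z powi crank P) * q ^ n"
      unfolding sum_distrib_right by (intro sum.cong) (auto simp: partitions_def)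
    ultimately show "((\<lambda>P. z powi crank P * q ^ sum_mset P) has_sum
            (\<Sum>P\<in>partitions n - {{#}}. z powi crank P) * q ^ n)
            {P \<in> {P. 0 \<notin># P \<and> P \<noteq> {#}}. sum_mset P = n}"
      using finite_partitions[of n] by (simp only: has_sum_finite_iff finite_Diff)
  qed
  moreover have "((\<lambda>n. (if n = 0 then 1 else if n = 1 then z - 1 else 0) * q ^ n) has_sum
      (1 + (z - 1) * q)) UNIV"
    by (rule has_sum_finite_neutralI[of "{0, 1}"]) auto
  ultimately have "((\<lambda>n. (\<Sum>P\<in>partitions n - {{#}}. z powi crank P) * q ^ n +
      (if n = 0 then 1 else if n = 1 then z - 1 else 0) * q ^ n) has_sum
      (crank_prod z q - 1 - (z - 1) * q + (1 + (z - 1) * q))) UNIV"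
    by (rule has_sum_add)
  also have "crank_prod z q - 1 - (z - 1) * q + (1 + (z - 1) * q) = crank_prod z q" by simp
  finally have "((\<lambda>n. crank_poly z n * q ^ n) has_sum crank_prod z q) UNIV"
    by (simp only: crank_poly_eq distrib_right)
  thus ?thesis by (rule has_sum_imp_sums)
qed

text \<open>At z = 1 every partition counts once and the anomaly z - 1 vanishes.\<close>

lemma npart_eq_crank_poly: "of_nat (npart n) = crank_poly 1 n"
proof (cases "n = 0")
  case True
  thus ?thesis by (simp add: crank_poly_eq npart_def partitions_0)
next
  case False
  hence "partitions n - {{#}} = partitions n" by (auto simp: partitions_def)
  thus ?thesis using False by (simp add: crank_poly_eq npart_def)
qed

section \<open>Crank deviations modulo 4\<close>

lemma fourth_roots_filter:
  fixes d :: int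
  shows "(1 + (-1) powi d + \<i> powi d + (-\<i>) powi d) / 4 = (if d mod 4 = 0 then 1 else 0 :: complex)"
proof -
  have d: "d = 4 * (d div 4) + d mod 4" by simp
  have per: "y powi d = y powi (d mod 4)" if "y ^ 4 = 1" "y \<noteq> 0" for y :: complex
  proof -
    have "y powi (4 * (d div 4)) = (y ^ 4) powi (d div 4)"
      using power_int_mult[of y 4 "d div 4"] by simp
    hence "y powi (4 * (d div 4)) = 1" using that by simp
    thus ?thesis using that by (subst d) (simp only: power_int_add simp_thms mult_1_left)
  qed
  have p: "(-1) powi d = (-1 :: complex) powi (d mod 4)" "\<i> powi d = \<i> powi (d mod 4)"
      "(-\<i>) powi d = (-\<i>) powi (d mod 4)"
    by (rule per; simp)+
  have "d mod 4 \<in> {0..<4}" by simp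
  also have "{0..<4 :: int} = {0, 1, 2, 3}" by auto
  finally show ?thesis unfolding p by (auto simp: power_int_def power3_eq_cube)
qed

text \<open>Shifting the filter by a multiplies the term of the root z by z^(-a); for z = -\<i> this
  is \<open>\<i> powi a\<close>, since 1/(-\<i>) = \<i>.\<close>

lemma Cres_eq:
  "Cres a 4 n - of_nat (npart n) / of_nat 4 =
     ((-1) powi a * crank_poly (-1) n + \<i> powi (- a) * crank_poly \<i> n + \<i> powi a * crank_poly (-\<i>) n) / 4"
proof -
  let ?C = "\<lambda>m. of_int (Ccrank m n) :: complex"
  have "Cres a 4 n = (\<Sum>\<^sub>\<infinity>m. ?C m * ((1 + (-1) powi (m - a) + \<i> powi (m - a) + (-\<i>) powi (m - a)) / 4))"
    unfolding Cres_def fourth_roots_filter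
    by (rule infsum_cong_neutral) (auto simp: mod_eq_dvd_iff mod_0_imp_dvd dvd_eq_mod_eq_0)
  also have "\<dots> = (\<Sum>m\<in>crank_support n. ?C m * ((1 + (-1) powi (m - a) + \<i> powi (m - a) + (-\<i>) powi (m - a)) / 4))"
    by (rule infsum_Ccrank)
  also have "\<dots> = (\<Sum>m\<in>crank_support n. (?C m * 1 powi m + (-1) powi a * (?C m * (-1) powi m) +
      \<i> powi (- a) * (?C m * \<i> powi m) + \<i> powi a * (?C m * (-\<i>) powi m)) / 4)"
  proof (rule sum.cong)
    fix m
    have "(-1) powi (m - a) = (-1) powi a * (-1 :: complex) powi m"
      by (simp add: power_int_diff divide_inverse power_int_minus[symmetric] power_int_minus_one_minus)
    moreover have "\<i> powi (m - a) = \<i> powi (- a) * \<i> powi m"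
      by (simp add: power_int_diff divide_inverse power_int_minus)
    moreover have "(-\<i>) powi (m - a) = \<i> powi a * (-\<i>) powi m"
    proof -
      have "inverse (-\<i>) = \<i>" by (simp add: complex_eq_iff)
      thus ?thesis by (simp add: power_int_diff divide_inverse flip: power_int_inverse)
    qed
    ultimately show "?C m * ((1 + (-1) powi (m - a) + \<i> powi (m - a) + (-\<i>) powi (m - a)) / 4) =
        (?C m * 1 powi m + (-1) powi a * (?C m * (-1) powi m) +
        \<i> powi (- a) * (?C m * \<i> powi m) + \<i> powi a * (?C m * (-\<i>) powi m)) / 4"
      by (simp add: algebra_simps)
  qed simp
  also have "\<dots> = (crank_poly 1 n + (-1) powi a * crank_poly (-1) n + \<i> powi (- a) * crank_poly \<i> n
      + \<i> powi a * crank_poly (-\<i>) n) / 4"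
    unfolding crank_poly_def infsum_Ccrank sum_divide_distrib[symmetric] sum.distrib
      sum_distrib_left ..
  finally show ?thesis unfolding npart_eq_crank_poly by (simp add: field_simps)
qed

lemma DC_eq:
  assumes "q \<noteq> 0" "norm q < 1"
  shows "DC a 4 q = ((-1) powi a * crank_prod (-1) q + (\<i> powi (- a) + \<i> powi a) * crank_prod \<i> q) / 4"
proof -
  have "(\<lambda>n. ((-1) powi a * (crank_poly (-1) n * q ^ n) + \<i> powi (- a) * (crank_poly \<i> n * q ^ n)
      + \<i> powi a * (crank_poly (-\<i>) n * q ^ n)) / 4) sums
      (((-1) powi a * crank_prod (-1) q + \<i> powi (- a) * crank_prod \<i> q + \<i> powi a * crank_prod (-\<i>) q) / 4)"
    using assms by (intro sums_divide sums_add sums_mult crank_poly_sums) auto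
  moreover have "crank_prod (-\<i>) q = crank_prod \<i> q"
    by (simp add: crank_prod_i[OF assms(2)])
  ultimately have "(\<lambda>n. (Cres a 4 n - of_nat (npart n) / of_nat 4) * q ^ n) sums
      (((-1) powi a * crank_prod (-1) q + (\<i> powi (- a) + \<i> powi a) * crank_prod \<i> q) / 4)"
    unfolding Cres_eq by (simp add: algebra_simps add_divide_distrib)
  thus ?thesis unfolding DC_def by (rule sums_unique[symmetric])
qed

theorem theorem1p5:
  fixes q :: complex
  assumes "0 < norm q" and "norm q < 1"
  shows "DC 0 4 q = vartheta4 q 3 (-1) 1 (-3) \<and>
         DC 1 4 q = vartheta4 q (-1) (-1) 1 1 \<and>
         DC 3 4 q = vartheta4 q (-1) (-1) 1 1 \<and>
         DC 2 4 q = vartheta4 q (-1) 3 (-3) 1"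
proof -
  have q: "q \<noteq> 0" "norm q < 1" using assms by auto
  note theta = vartheta4_eq[OF q]
  have i3: "\<i> ^ 3 = - \<i>" "inverse \<i> = - \<i>" by (simp_all add: power3_eq_cube)
  \<comment> \<open>The pairs (c, d) are read off from c = (-1)^a and 2d = \<i>^a + \<i>^(-a): (1,
    1) for a = 0, (-1, 0) for both odd residues, (1, -1) for a = 2.\<close>
  show ?thesis
    using theta[of 1 1] theta[of "-1" 0] theta[of 1 "-1"]
    by (simp add: DC_eq[OF q] power_int_minus i3)
qed

end
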